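(* Let $P$, $w$, $\theta_p$, $\theta_w$, $X_{\underline{\theta}}$, $A$, $b$, $U,V,W$ be as in the context. Let $T\subseteq C_0(\mathbb{R}_+)$ be convex and let $f_0:C_0(\mathbb{R}_+)\to\mathbb{R}$ be convex and continuous, and assume $b\in A(X_{\underline{\theta}}\cap \operatorname{int}T)$. Write $A^{-1}b=\{e\in C_0(\mathbb{R}_+)\mid Ae=b\}$. (1) If $\theta_w+\theta_p=1$ (in which case the closure of $X_{\underline{\theta}}$ is $C_0(\mathbb{R}_+)$), then $$\inf_{e\in T\cap X_{\underline{\theta}}\cap A^{-1}b} f_0(e)=\max_{\mu\in U\oplus V\oplus W}\big[\langle \operatorname{Proj}_U(\mu),w\rangle-(f_0+\iota_T)^*(\mu)\big].$$ (2) If $\theta_w+\theta_p>1$ (in which case the closure of $X_{\underline{\theta}}$ is $\{\varphi\in C_0(\mathbb{R}_+)\mid\varphi(0)=\alpha\}$ with $\alpha=w(0+)$), then $$\inf_{e\in T\cap X_{\underline{\theta}}\cap A^{-1}b} f_0(e)=\max_{\mu\in U\oplus V\oplus W}\big[\langle \operatorname{Proj}_U(\mu),w\rangle+(f_0+\iota_T)^{\#}(\mu)\big],$$ where, for any $f:C_0(\mathbb{R}_+)\to\mathbb{R}\cup\{+\infty\}$ and any $\mu\in\mathbf{M}(\mathbb{R}_+)$, $$f^{\#}(\mu):=\max_{\lambda\in\mathbb{R}}\,[\alpha\lambda-f^*(\mu+\lambda\delta)],\qquad \alpha:=w(0+),$$ and $\delta$ is the Dirac measure at $0\in\mathbb{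R}_+$.
   Context: $\mathbb{R}_+=[0,\infty)$; $\hat g$ denotes the Laplace transform of $g$. $C_0(\mathbb{R}_+)$ is the Banach space of continuous $\varphi:\mathbb{R}_+\to\mathbb{R}$ with $\lim_{t\to\infty}\varphi(t)=0$, with the supremum norm. Its dual is $\mathbf{M}(\mathbb{R}_+)$, the regular finite signed Borel measures on $\mathbb{R}_+$ with the variation norm, with pairing $\langle\mu,e\rangle=\int e\,d\mu$. $\iota_T$ is the indicator function ($0$ on $T$, $+\infty$ off $T$). For $f:C_0(\mathbb{R}_+)\to\mathbb{R}\cup\{+\infty\}$, $f^*(\mu)=\sup_{e\in C_0(\mathbb{R}_+)}(\langle\mu,e\rangle-f(e))$. Values are in the extended reals. Plant: $P$ is a proper real-rational function with a zero of order $\theta_p\ge 0$ at infinity (denominator degree minus numerator degree equals $\theta_p$). Reference input: $w:\mathbb{R}_+\to\mathbb{R}$ is an ordinary function (no delta terms) with rational Laplace transform $\hat w$ having a zero of order exactly $\theta_w\ge1$ at infinity. $P$ has poles $p_1,\dots,p_m$ and zeros $z_1,\dots,z_n$ in the closed right half-plane $\{\operatorname{Re}s\ge0\}$, and $\hat w$ has zeros $v_1,\dots,v_l$ there; none of these lie on the imaginary axis, and all are simple and mutually distinct. $X_{\underline{\theta}}$ is the set of $e\in C_0(\mathbb{R}_+)$ such that $\hat e$ is rational, $\hat e$ has a zero of order at least $\theta_w$ at infinity, and $\hat e-\hat w$ has a zero of order at least $\theta_p+\theta_w$ at infinity. From each complex-conjugate pair among the $z_i$ retain only one member; similarly for the $p_i$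 and the $v_i$. To each retained $z=x+iy$ associate the functions $t\mapsto e^{-xt}\cos yt$ and (if $y\ne0$) $t\mapsto e^{-xt}\sin yt$; list all of these as $\mathbf{a}_1,\mathbf{a}_2,\dots$. Define $\mathbf{b}_1,\mathbf{b}_2,\dots$ and $\mathbf{c}_1,\mathbf{c}_2,\dots$ in the same way from the $p_i$ and from the $v_i$. For functions, $\langle u,v\rangle=\int_0^\infty u(t)v(t)\,dt$. Define the bounded linear map $A$ from $C_0(\mathbb{R}_+)$ into the appropriate finite-dimensional real space by $Ae=((\langle e,\mathbf{a}_i\rangle)_i,(\langle e,\mathbf{b}_i\rangle)_i,(\langle e,\mathbf{c}_i\rangle)_i)$, and the vector $b=((\langle w,\mathbf{a}_i\rangle)_i,0,0)$. $U,V,W$ are the spans of the $\mathbf{a}_i$, the $\mathbf{b}_i$, the $\mathbf{c}_i$ respectively. Each $e^*\in U\oplus V\oplus W$ is identified with the measure $\mu(E)=\int_E e^*(t)\,dt$, so $U\oplus V\oplus W\subset\mathbf{M}(\mathbb{R}_+)$. $\operatorname{Proj}_U$ is the natural projector of $U\oplus V\oplus W$ onto $U$, and $\langle \operatorname{Proj}_U(\mu),w\rangle$ is the integral of $w$ times the function in $U$. *)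

theory Defs
  imports "HOL-Analysis.Analysis" "HOL-Computational_Algebra.Polynomial"
begin

text \<open>A function on the half-line is encoded as a function on the reals that is zero on the
  negative reals; no continuity from the left at 0 is required.\<close>

typedef c0 = "{f :: real \<Rightarrow> real. continuous_on {0..} f \<and> (f \<longlongrightarrow> 0) at_top \<and> (\<forall>t<0. f t = 0)}"
  morphisms ev Abs_c0
  by (rule exI[of _ "\<lambda>_. 0"]) auto

setup_lifting type_definition_c0

lemma c0_eqI: "(\<And>t. 0 \<le> t \<Longrightarrow> ev f t = ev g t) \<Longrightarrow> f = g"
proof -
  assume a: "\<And>t. 0 \<le> t \<Longrightarrow> ev f t = ev g t"
  have "ev f t = ev g t" for t
    using a[of t] ev[of f] ev[of g] by (cases "0 \<le> t") auto
  then show ?thesis by (simp add: ev_inject[symmetric] fun_eq_iff)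
qed

lemma continuous_on_ev: "continuous_on {0..} (ev f)"
  and tendsto_ev: "(ev f \<longlongrightarrow> 0) at_top"
  and ev_neg: "t < 0 \<Longrightarrow> ev f t = 0"
  using ev[of f] by auto

lemma bounded_ev: "\<exists>B. \<forall>t. \<bar>ev f t\<bar> \<le> B"
proof -
  have "eventually (\<lambda>t. dist (ev f t) 0 < 1) at_top"
    using tendsto_ev[of f] by (rule tendstoD) simp
  then obtain N where N: "\<And>t. t \<ge> N \<Longrightarrow> \<bar>ev f t\<bar> < 1"
    by (auto simp: eventually_at_top_linorder)
  have "compact (ev f ` {0..N})"
    by (intro compact_continuous_image continuous_on_subset[OF continuous_on_ev]) auto
  then obtain B where B: "\<And>t. t \<in> {0..N} \<Longrightarrow> \<bar>ev f t\<bar> \<le> B"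
    by (force dest!: compact_imp_bounded simp: bounded_iff)
  have "\<bar>ev f t\<bar> \<le> max 1 B" for t
    using N[of t] B[of t] ev_neg[of t f] by (cases "t < 0"; cases "t \<ge> N") force+
  then show ?thesis by blast
qed

instantiation c0 :: real_vector
begin

lift_definition zero_c0 :: c0 is "\<lambda>_. 0" by auto
lift_definition plus_c0 :: "c0 \<Rightarrow> c0 \<Rightarrow> c0" is "\<lambda>f g t. f t + g t"
  by (auto intro!: continuous_intros tendsto_add_zero)
lift_definition minus_c0 :: "c0 \<Rightarrow> c0 \<Rightarrow> c0" is "\<lambda>f g t. f t - g t"
  by (auto intro!: continuous_intros) (use tendsto_diff in fastforce)
lift_definition uminus_c0 :: "c0 \<Rightarrow> c0" is "\<lambda>f t. - f t"
  by (auto intro!: continuous_intros) (use tendsto_minus in fastforce)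
lift_definition scaleR_c0 :: "real \<Rightarrow> c0 \<Rightarrow> c0" is "\<lambda>c f t. c * f t"
  by (auto intro!: continuous_intros tendsto_mult_right_zero)

instance
  by standard (transfer; auto simp: algebra_simps)+

end

lemmas ev_simps [simp] = zero_c0.rep_eq plus_c0.rep_eq minus_c0.rep_eq uminus_c0.rep_eq scaleR_c0.rep_eq

instantiation c0 :: real_normed_vector
begin

definition norm_c0 :: "c0 \<Rightarrow> real" where
  "norm_c0 f = (SUP t\<in>{0..}. \<bar>ev f t\<bar>)"
definition dist_c0 :: "c0 \<Rightarrow> c0 \<Rightarrow> real" where
  "dist_c0 f g = norm (f - g)"
definition sgn_c0 :: "c0 \<Rightarrow> c0" where
  "sgn_c0 f = scaleR (inverse (norm f)) f"
definition uniformity_c0 :: "(c0 \<times> c0) filter" where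
  "uniformity_c0 = (INF e\<in>{0<..}. principal {(x, y). dist x y < e})"
definition open_c0 :: "c0 set \<Rightarrow> bool" where
  "open_c0 U \<longleftrightarrow> (\<forall>x\<in>U. \<forall>\<^sub>F (x', y) in uniformity. x' = x \<longrightarrow> y \<in> U)"

lemma abs_ev_le_norm: "\<bar>ev f t\<bar> \<le> norm f"
proof -
  have bdd: "bdd_above ((\<lambda>t. \<bar>ev f t\<bar>) ` {0..})"
    using bounded_ev[of f] by (auto simp: bdd_above_def)
  have "\<bar>ev f t\<bar> \<le> norm f" if "0 \<le> t" for t
    unfolding norm_c0_def using bdd that by (intro cSUP_upper) auto
  from this[of t] this[of 0] show ?thesis
    by (cases "0 \<le> t") (auto simp: ev_neg)
qed

lemma norm_c0_leI: "(\<And>t. 0 \<le> t \<Longrightarrow> \<bar>ev f t\<bar> \<le> B) \<Longrightarrow> norm f \<le> B" for f :: c0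
  unfolding norm_c0_def by (rule cSUP_least) auto

instance
proof
  fix f g :: c0 and a :: real
  show "dist f g = norm (f - g)" by (rule dist_c0_def)
  show "sgn f = inverse (norm f) *\<^sub>R f" by (rule sgn_c0_def)
  show "uniformity = (INF e\<in>{0<..}. principal {(x :: c0, y). dist x y < e})"
    by (rule uniformity_c0_def)
  show "open U \<longleftrightarrow> (\<forall>x\<in>U. \<forall>\<^sub>F (x', y) in uniformity. x' = x \<longrightarrow> y \<in> U)" for U :: "c0 set"
    by (rule open_c0_def)
  show "norm f = 0 \<longleftrightarrow> f = 0"
  proof
    assume "norm f = 0"
    then have "ev f t = 0" for t using abs_ev_le_norm[of f t] by simp
    then show "f = 0" by (intro c0_eqI) simp
  qed (simp add: norm_c0_def)
  show "norm (f + g) \<le> norm f + norm g"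
  proof (rule norm_c0_leI)
    fix t show "\<bar>ev (f + g) t\<bar> \<le> norm f + norm g"
      using abs_ev_le_norm[of f t] abs_ev_le_norm[of g t] by simp
  qed
  have le: "norm (a *\<^sub>R f) \<le> \<bar>a\<bar> * norm f" for a :: real and f :: c0
    by (rule norm_c0_leI) (simp add: abs_mult mult_left_mono abs_ev_le_norm)
  show "norm (a *\<^sub>R f) = \<bar>a\<bar> * norm f"
  proof (cases "a = 0")
    case False
    have "norm f = norm (inverse a *\<^sub>R (a *\<^sub>R f))" using False by simp
    also have "\<dots> \<le> \<bar>inverse a\<bar> * norm (a *\<^sub>R f)" by (rule le)
    finally have "\<bar>a\<bar> * norm f \<le> norm (a *\<^sub>R f)" using False by (simp add: field_simps)
    with le[of a f] show ?thesis by simp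
  qed (simp add: norm_c0_def)
qed

end

instance c0 :: banach
proof
  fix X :: "nat \<Rightarrow> c0"
  assume X: "Cauchy X"
  have ucs: "uniformly_convergent_on UNIV (\<lambda>n. ev (X n))"
  proof (rule Cauchy_uniformly_convergent, rule uniformly_Cauchy_onI)
    fix e :: real assume "e > 0"
    then obtain M where M: "\<And>m n. m \<ge> M \<Longrightarrow> n \<ge> M \<Longrightarrow> dist (X m) (X n) < e"
      using metric_CauchyD[OF X] by blast
    have "dist (ev (X m) t) (ev (X n) t) < e" if "m \<ge> M" "n \<ge> M" for m n t
      using M[OF that] abs_ev_le_norm[of "X m - X n" t] by (simp add: dist_norm)
    then show "\<exists>M. \<forall>t\<in>UNIV. \<forall>m\<ge>M. \<forall>n\<ge>M. dist (ev (X m) t) (ev (X n) t) < e" by blast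
  qed
  then obtain l where l: "uniform_limit UNIV (\<lambda>n. ev (X n)) l sequentially"
    by (auto simp: uniformly_convergent_on_def)
  have lc: "continuous_on {0..} l"
    by (rule uniform_limit_theorem[OF _ uniform_limit_on_subset[OF l]])
       (auto simp: continuous_on_ev)
  have ln: "l t = 0" if "t < 0" for t
    using tendsto_uniform_limitI[OF l, of t] that by (simp add: ev_neg LIMSEQ_const_iff)
  have lt: "(l \<longlongrightarrow> 0) at_top"
    by (rule swap_uniform_limit'[where g = "\<lambda>_. 0" and S = UNIV, OF _ _ l])
       (auto simp: tendsto_ev)
  define L where "L = Abs_c0 l"
  have evL: "ev L = l" unfolding L_def by (subst Abs_c0_inverse) (use lc ln lt in auto)
  have "X \<longlonglongrightarrow> L"
  proof (rule LIMSEQ_I)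
    fix r :: real assume r: "r > 0"
    then have "\<forall>\<^sub>F n in sequentially. \<forall>t\<in>UNIV. dist (ev (X n) t) (l t) < r / 2"
      using l by (intro uniform_limitD) auto
    then obtain N where N: "\<And>n t. n \<ge> N \<Longrightarrow> \<bar>ev (X n) t - l t\<bar> < r / 2"
      by (auto simp: eventually_sequentially dist_real_def)
    have "norm (X n - L) \<le> r / 2" if "n \<ge> N" for n
      using N[OF that] by (intro norm_c0_leI) (auto simp: evL intro: less_imp_le)
    then show "\<exists>N. \<forall>n\<ge>N. norm (X n - L) < r" using r by (intro exI[of _ N]) force
  qed
  then show "convergent X" by (auto simp: convergent_def)
qed

abbreviation half_borel :: "real measure" where
  "half_borel \<equiv> restrict_space borel {0..}"

text \<open>Regularity is automatic for finite Borel measures on the half-line.  A measure is encoded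
  as a set function that vanishes on the sets that are not measurable.\<close>

typedef smeasure = "{\<mu> :: real set \<Rightarrow> real.
    (\<forall>E. E \<notin> sets half_borel \<longrightarrow> \<mu> E = 0) \<and>
    (\<forall>E :: nat \<Rightarrow> real set. range E \<subseteq> sets half_borel \<longrightarrow> disjoint_family E \<longrightarrow>
      (\<lambda>n. \<mu> (E n)) sums \<mu> (\<Union>n. E n))}"
  morphisms smeas Abs_smeasure
  by (rule exI[of _ "\<lambda>_. 0"]) auto

setup_lifting type_definition_smeasure

instantiation smeasure :: real_vector
begin

lift_definition zero_smeasure :: smeasure is "\<lambda>_. 0" by auto
lift_definition plus_smeasure :: "smeasure \<Rightarrow> smeasure \<Rightarrow> smeasure" is "\<lambda>\<mu> \<nu> E. \<mu> E + \<nu> E"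
  by (auto intro!: sums_add)
lift_definition minus_smeasure :: "smeasure \<Rightarrow> smeasure \<Rightarrow> smeasure" is "\<lambda>\<mu> \<nu> E. \<mu> E - \<nu> E"
  by (auto intro!: sums_diff)
lift_definition uminus_smeasure :: "smeasure \<Rightarrow> smeasure" is "\<lambda>\<mu> E. - \<mu> E"
  by (auto intro!: sums_minus)
lift_definition scaleR_smeasure :: "real \<Rightarrow> smeasure \<Rightarrow> smeasure" is "\<lambda>c \<mu> E. c * \<mu> E"
  by (auto intro!: sums_mult)

instance
  by standard (transfer; auto simp: algebra_simps)+

end

lift_definition delta0 :: smeasure is
  "\<lambda>E. if E \<in> sets half_borel then indicator E (0 :: real) else 0"
proof (intro CollectI conjI allI impI)
  fix E :: "nat \<Rightarrow> real set"
  assume E: "range E \<subseteq> sets half_borel" "disjoint_family E"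
  then have "(\<lambda>n. indicator (E n) (0 :: real) :: real) sums (indicator (\<Union>n. E n) 0 :: real)"
    by (intro indicator_sums) (auto simp: disjoint_family_on_def)
  moreover have "(\<Union>n. E n) \<in> sets half_borel" using E by (intro sets.countable_UN) auto
  ultimately show "(\<lambda>n. if E n \<in> sets half_borel then (indicator (E n) (0 :: real) :: real) else 0)
      sums (if (\<Union>n. E n) \<in> sets half_borel then indicator (\<Union>n. E n) (0 :: real) else 0)"
    using E by (simp add: range_subsetD)
qed auto

text \<open>The measure with Lebesgue density g, for g integrable on the half-line (and 0 otherwise).\<close>

lift_definition dens :: "(real \<Rightarrow> real) \<Rightarrow> smeasure" is
  "\<lambda>g E. if set_integrable lborel {0..} g \<and> E \<in> sets half_borel
         then set_lebesgue_integral lborel E g else 0"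
proof (intro CollectI conjI allI impI)
  fix g :: "real \<Rightarrow> real" and E :: "nat \<Rightarrow> real set"
  assume E: "range E \<subseteq> sets half_borel" "disjoint_family E"
  have U: "(\<Union>n. E n) \<in> sets half_borel" using E by (intro sets.countable_UN) auto
  have b: "E n \<in> sets borel" "E n \<subseteq> {0..}" for n
    using range_subsetD[OF E(1), of n] by (auto simp: sets_restrict_space)
  show "(\<lambda>n. if set_integrable lborel {0..} g \<and> E n \<in> sets half_borel
           then set_lebesgue_integral lborel (E n) g else 0)
      sums (if set_integrable lborel {0..} g \<and> (\<Union>n. E n) \<in> sets half_borel
           then set_lebesgue_integral lborel (\<Union>n. E n) g else 0)"
  proof (cases "set_integrable lborel {0..} g")
    case True
    have i: "set_integrable lborel (\<Union>n. E n) g"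
      by (rule set_integrable_subset[OF True]) (use b in auto)
    have iE: "set_integrable lborel (E n) g" for n
      by (rule set_integrable_subset[OF True]) (use b in auto)
    have UE: "(\<Union>n. \<Union>i<n. E i) = (\<Union>n. E n)" by blast
    have fin: "(\<Sum>i<n. set_lebesgue_integral lborel (E i) g)
        = set_lebesgue_integral lborel (\<Union>i<n. E i) g" for n
      using E(2) iE b
      by (intro set_integral_finite_Union[symmetric]) (auto simp: disjoint_family_on_def)
    have "(\<lambda>n. set_lebesgue_integral lborel (\<Union>i<n. E i) g)
        \<longlonglongrightarrow> set_lebesgue_integral lborel (\<Union>n. \<Union>i<n. E i) g"
    proof (rule set_integral_cont_up)
      show "incseq (\<lambda>n. \<Union>i<n. E i)" by (force simp: incseq_def)
    qed (use b i in \<open>auto simp: UE\<close>)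
    then have "(\<lambda>n. set_lebesgue_integral lborel (E n) g)
        sums set_lebesgue_integral lborel (\<Union>n. E n) g"
      by (simp add: sums_def fin UE)
    then show ?thesis using True U E by (simp add: range_subsetD)
  qed auto
qed auto

text \<open>Jordan decomposition: the upper variation of \<open>\<mu>\<close> (the map ennreal sends negative reals
  to 0, and the empty set always contributes 0).\<close>

definition upper_var :: "smeasure \<Rightarrow> real measure" where
  "upper_var \<mu> = measure_of {0..} (sets half_borel)
     (\<lambda>E. SUP F\<in>{F \<in> sets half_borel. F \<subseteq> E}. ennreal (smeas \<mu> F))"

definition pairing :: "smeasure \<Rightarrow> c0 \<Rightarrow> real" where
  "pairing \<mu> e = integral\<^sup>L (upper_var \<mu>) (ev e) - integral\<^sup>L (upper_var (- \<mu>)) (ev e)"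

definition conjugate :: "(c0 \<Rightarrow> ereal) \<Rightarrow> smeasure \<Rightarrow> ereal" where
  "conjugate f \<mu> = (SUP e. ereal (pairing \<mu> e) - f e)"

definition ind :: "c0 set \<Rightarrow> c0 \<Rightarrow> ereal" where
  "ind T e = (if e \<in> T then 0 else \<infinity>)"

definition is_max :: "ereal \<Rightarrow> ereal set \<Rightarrow> bool" where
  "is_max m S \<longleftrightarrow> m \<in> S \<and> (\<forall>x\<in>S. x \<le> m)"

text \<open>The function maximised over the real number l in the definition of \<open>f\<^sup>#\<close>.  The value \<open>f\<^sup>#\<close> itself is defined
  as a supremum, so that it makes sense for all f; that it is a maximum has to be asserted
  separately where it is used.\<close>

definition sharp_obj :: "real \<Rightarrow> (c0 \<Rightarrow> ereal) \<Rightarrow> smeasure \<Rightarrow> real \<Rightarrow> ereal" where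
  "sharp_obj \<alpha> f \<mu> l = ereal (\<alpha> * l) - conjugate f (\<mu> + l *\<^sub>R delta0)"

definition sharp :: "real \<Rightarrow> (c0 \<Rightarrow> ereal) \<Rightarrow> smeasure \<Rightarrow> ereal" where
  "sharp \<alpha> f \<mu> = (SUP l. sharp_obj \<alpha> f \<mu> l)"

definition laplace :: "(real \<Rightarrow> real) \<Rightarrow> complex \<Rightarrow> complex" where
  "laplace g s = set_lebesgue_integral lborel {0..} (\<lambda>t. exp (- s * of_real t) * of_real (g t))"

definition laplace_converges :: "(real \<Rightarrow> real) \<Rightarrow> bool" where
  "laplace_converges g \<longleftrightarrow> (\<exists>\<sigma>. \<forall>s. Re s > \<sigma> \<longrightarrow>
     set_integrable lborel {0..} (\<lambda>t. exp (- s * of_real t) * of_real (g t)))"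

text \<open>F is the rational function \<open>p / q\<close>.  A Laplace transform is only given by its integral on a
  right half-plane, so equality is required there; this determines the rational function.\<close>

definition is_rational :: "(complex \<Rightarrow> complex) \<Rightarrow> complex poly \<Rightarrow> complex poly \<Rightarrow> bool" where
  "is_rational F p q \<longleftrightarrow> q \<noteq> 0 \<and> (\<exists>\<sigma>. \<forall>s. Re s > \<sigma> \<longrightarrow> F s = poly p s / poly q s)"

text \<open>F is rational with a zero of order at least k at infinity; the zero function has a zero of
  every order.  The degree difference does not depend on the choice of p and q.\<close>

definition zero_at_inf_ge :: "(complex \<Rightarrow> complex) \<Rightarrow> nat \<Rightarrow> bool" where
  "zero_at_inf_ge F k \<longleftrightarrow> (\<exists>p q. is_rational F p q \<and> (p = 0 \<or> degree p + k \<le> degree q))"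

definition X_theta :: "nat \<Rightarrow> nat \<Rightarrow> (real \<Rightarrow> real) \<Rightarrow> c0 set" where
  "X_theta \<theta>\<^sub>p \<theta>\<^sub>w w = {e. zero_at_inf_ge (laplace (ev e)) \<theta>\<^sub>w \<and>
     zero_at_inf_ge (\<lambda>s. laplace (ev e) s - laplace w s) (\<theta>\<^sub>p + \<theta>\<^sub>w)}"

definition rhp_roots :: "complex poly \<Rightarrow> complex set" where
  "rhp_roots p = {s. 0 \<le> Re s \<and> poly p s = 0}"

text \<open>The list zs contains exactly one member of each conjugate pair in S (and each real element
  of S).\<close>

definition conj_reps :: "complex set \<Rightarrow> complex list \<Rightarrow> bool" where
  "conj_reps S zs \<longleftrightarrow> distinct zs \<and> set zs \<subseteq> S \<and>
     (\<forall>z\<in>S. \<exists>!r. r \<in> set zs \<and> (r = z \<or> r = cnj z))"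

definition modes :: "complex \<Rightarrow> (real \<Rightarrow> real) list" where
  "modes z = (\<lambda>t. exp (- Re z * t) * cos (Im z * t)) #
     (if Im z = 0 then [] else [\<lambda>t. exp (- Re z * t) * sin (Im z * t)])"

definition mode_list :: "complex list \<Rightarrow> (real \<Rightarrow> real) list" where
  "mode_list zs = concat (map modes zs)"

definition ip :: "(real \<Rightarrow> real) \<Rightarrow> (real \<Rightarrow> real) \<Rightarrow> real" where
  "ip u v = set_lebesgue_integral lborel {0..} (\<lambda>t. u t * v t)"

text \<open>The finite-dimensional target space is a product of three spaces of real lists of fixed
  length.\<close>

definition opA :: "complex list \<Rightarrow> complex list \<Rightarrow> complex list \<Rightarrow> c0 \<Rightarrow>
    real list \<times> real list \<times> real list" where
  "opA zs ps vs e = (map (ip (ev e)) (mode_list zs), map (ip (ev e)) (mode_list ps),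
     map (ip (ev e)) (mode_list vs))"

definition vecb :: "complex list \<Rightarrow> complex list \<Rightarrow> complex list \<Rightarrow> (real \<Rightarrow> real) \<Rightarrow>
    real list \<times> real list \<times> real list" where
  "vecb zs ps vs w = (map (ip w) (mode_list zs), map (\<lambda>_. 0) (mode_list ps),
     map (\<lambda>_. 0) (mode_list vs))"

definition fun_span :: "(real \<Rightarrow> real) list \<Rightarrow> (real \<Rightarrow> real) set" where
  "fun_span gs = {g. \<exists>c :: nat \<Rightarrow> real. g = (\<lambda>t. \<Sum>i<length gs. c i * (gs ! i) t)}"

definition sum3 :: "(real \<Rightarrow> real) set \<Rightarrow> (real \<Rightarrow> real) set \<Rightarrow> (real \<Rightarrow> real) set \<Rightarrow>
    (real \<Rightarrow> real) set" where
  "sum3 U V W = {g. \<exists>u\<in>U. \<exists>v\<in>V. \<exists>x\<in>W. g = (\<lambda>t. u t + v t + x t)}"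

text \<open>The projection onto U along V and W; meaningful when the sum is direct.\<close>

definition proj1 :: "(real \<Rightarrow> real) set \<Rightarrow> (real \<Rightarrow> real) set \<Rightarrow> (real \<Rightarrow> real) set \<Rightarrow>
    (real \<Rightarrow> real) \<Rightarrow> real \<Rightarrow> real" where
  "proj1 U V W g = (THE u. u \<in> U \<and> (\<exists>v\<in>V. \<exists>x\<in>W. g = (\<lambda>t. u t + v t + x t)))"

end

theory Submission
  imports Defs
begin

text \<open>
  Weak duality is immediate. On a feasible signal \<open>e\<close> the conditions \<open>A e = b\<close> fix the pairings
  with all modes, so that \<open>\<mu> = u + v + x\<close> satisfies \<open>\<langle>\<mu>, e\<rangle> = \<langle>u, w\<rangle>\<close>, and the value of the dual
  objective at \<open>\<mu>\<close> is at most \<open>f0 e\<close>. It remains to find, for every real lower bound \<open>v\<close> of \<open>f0\<close> on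
  the feasible set, a multiplier whose dual value is at least \<open>v\<close> (\<open>is_max_dualI\<close>).

  Fix a feasible \<open>e0\<close> in the interior of \<open>T\<close> and put \<open>N = \<theta>\<^sub>p + \<theta>\<^sub>w\<close>. The set \<open>X\<close> is the translate by \<open>e0\<close>
  of the space \<open>M\<close> of signals whose transform is rational with a zero of order at least \<open>N\<close> at
  infinity (\<open>X_theta_iff_diff_rational\<close>), and the feasible set is \<open>T \<inter> (e0 + K)\<close>, where \<open>K\<close> consists of
  the elements of \<open>M\<close> that are orthogonal to all modes. The Hahn-Banach theorem gives a bounded linear
  functional \<open>l\<close> that vanishes on \<open>K\<close> and satisfies \<open>v + l (e - e0) \<le> f0 e\<close> on \<open>T\<close>
  (\<open>affine_minorant_on_subspace_constraint\<close>). On \<open>M\<close> it vanishes on the common kernel of finitely many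
  functionals, so there it is a combination of the pairings with the modes
  (\<open>functional_vanishing_on_common_kernel\<close>). Both sides are continuous, and \<open>M\<close> is dense in the whole
  space if \<open>N = 1\<close> and in the signals that vanish at 0 if \<open>N > 1\<close> (\<open>rational_signals_dense\<close>). Hence \<open>l\<close>
  is the integral against an element of \<open>U + V + W\<close>, plus, if \<open>N > 1\<close>, a multiple of the evaluation at 0
  (\<open>supporting_mode_functional\<close>). This is the required multiplier, with the Dirac measure at 0
  accounting for the evaluation. That the maximum in the definition of \<open>f\<^sup>#\<close> is attained is the same
  duality for the single constraint \<open>e 0 = \<alpha>\<close> (\<open>sharp_attained\<close>).

  Density is Bernstein's approximation theorem in the variable \<open>x = exp (- t)\<close>: the Bernstein term
  \<open>x\<^sup>k (1 - x)\<^sup>n\<close> has the transform \<open>n! / ((s + k) (s + k + 1) \<dots> (s + k + n))\<close>, which has a zero of order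
  \<open>n + 1\<close> at infinity (\<open>laplace_one_minus_exp_power\<close>). That all elements of \<open>X\<close> take the value \<open>\<alpha>\<close> at 0
  if \<open>N > 1\<close> is the initial value theorem. The projection onto \<open>U\<close> makes sense because distinct complex
  exponentials are linearly independent (\<open>exponentials_independent\<close>).
\<close>

section \<open>Affine minorants of convex functions\<close>

definition sublinear :: "('a::real_vector \<Rightarrow> real) \<Rightarrow> bool" where
  "sublinear p \<longleftrightarrow> (\<forall>x y. p (x + y) \<le> p x + p y) \<and> (\<forall>c x. 0 < c \<longrightarrow> p (c *\<^sub>R x) = c * p x)"

lemma sublinearI:
  assumes "\<And>x y. p (x + y) \<le> p x + p y" "\<And>c x. 0 < c \<Longrightarrow> p (c *\<^sub>R x) \<le> c * p x"
  shows "sublinear p"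
  unfolding sublinear_def
proof (intro conjI allI impI)
  fix c :: real and x assume c: "0 < c"
  have "p x = p (inverse c *\<^sub>R (c *\<^sub>R x))" using c by simp
  also have "\<dots> \<le> inverse c * p (c *\<^sub>R x)" using c by (intro assms(2)) simp
  finally have "c * p x \<le> p (c *\<^sub>R x)" using c by (simp add: field_simps)
  with assms(2)[OF c, of x] show "p (c *\<^sub>R x) = c * p x" by simp
qed (rule assms(1))

lemma sublinear_add: "sublinear p \<Longrightarrow> p (x + y) \<le> p x + p y"
  and sublinear_scale: "sublinear p \<Longrightarrow> 0 < c \<Longrightarrow> p (c *\<^sub>R x) = c * p x"
  by (auto simp: sublinear_def)

lemma sublinear_0: "sublinear p \<Longrightarrow> p 0 = 0"
  using sublinear_scale[of p 2 0] by simp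

lemma sublinear_minus: "sublinear p \<Longrightarrow> - p (- x) \<le> p x"
  using sublinear_add[of p x "- x"] sublinear_0[of p] by simp

text \<open>Zorn's lemma applied downwards. The pointwise infimum of a chain is finite, because every
  sublinear \<open>q \<le> p\<close> satisfies \<open>- p (- x) \<le> q x\<close>. It is subadditive because of two members of the chain
  one is below the other at both arguments.\<close>

lemma minimal_sublinear_exists:
  assumes p: "sublinear p"
  shows "\<exists>q. sublinear q \<and> q \<le> p \<and> (\<forall>r. sublinear r \<longrightarrow> r \<le> q \<longrightarrow> r = q)"
proof -
  define A where "A = {q. sublinear q \<and> q \<le> p}"
  have "\<exists>m\<in>A. \<forall>a\<in>A. m \<ge> a \<longrightarrow> a = m"
  proof (rule predicate_Zorn)
    show "partial_order_on A (relation_of (\<ge>) A)"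
      by (rule partial_order_on_relation_ofI) auto
  next
    fix C assume C: "C \<in> Chains (relation_of (\<ge>) A)"
    then have CA: "C \<subseteq> A" and tot: "\<And>q r. q \<in> C \<Longrightarrow> r \<in> C \<Longrightarrow> q \<le> r \<or> r \<le> q"
      by (auto simp: Chains_def relation_of_def)
    show "\<exists>u\<in>A. \<forall>a\<in>C. a \<ge> u"
    proof (cases "C = {}")
      case True
      then show ?thesis using p by (auto simp: A_def)
    next
      case False
      define u where "u x = (INF q\<in>C. q x)" for x
      have bdd: "bdd_below ((\<lambda>q. q x) ` C)" for x
      proof (rule bdd_belowI2)
        fix q assume "q \<in> C"
        then have "sublinear q" "q \<le> p" using CA by (auto simp: A_def)
        then show "- p (- x) \<le> q x"
          using sublinear_minus[of q x] le_funD[of q p "- x"] by linarith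
      qed
      have u_le: "u x \<le> q x" if "q \<in> C" for q x
        unfolding u_def using bdd that by (rule cINF_lower)
      have sub: "sublinear q" if "q \<in> C" for q using CA that by (auto simp: A_def)
      have "sublinear u"
      proof (rule sublinearI)
        fix x y
        have *: "u (x + y) \<le> q x + r y" if "q \<in> C" "r \<in> C" for q r
          using tot[OF that]
        proof
          assume "q \<le> r"
          then have "q y \<le> r y" by (simp add: le_fun_def)
          with u_le[OF that(1), of "x + y"] sublinear_add[OF sub[OF that(1)], of x y] show ?thesis by simp
        next
          assume "r \<le> q"
          then have "r x \<le> q x" by (simp add: le_fun_def)
          with u_le[OF that(2), of "x + y"] sublinear_add[OF sub[OF that(2)], of x y] show ?thesis by simp
        qed
        have "u (x + y) - r y \<le> u x" if "r \<in> C" for r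
          unfolding u_def[of x] using False *[OF _ that] by (intro cINF_greatest) (auto simp: algebra_simps)
        then have "u (x + y) - u x \<le> u y"
          unfolding u_def[of y] using False by (intro cINF_greatest) (auto simp: algebra_simps)
        then show "u (x + y) \<le> u x + u y" by simp
      next
        fix c :: real and x :: 'a assume c: "0 < c"
        have "u (c *\<^sub>R x) / c \<le> u x"
          unfolding u_def[of x]
        proof (rule cINF_greatest[OF False])
          fix q assume q: "q \<in> C"
          show "u (c *\<^sub>R x) / c \<le> q x"
            using u_le[OF q, of "c *\<^sub>R x"] sublinear_scale[OF sub[OF q] c, of x] c
            by (simp add: field_simps)
        qed
        then show "u (c *\<^sub>R x) \<le> c * u x" using c by (simp add: field_simps)
      qed
      moreover have "u \<le> p"
      proof -
        from False obtain q where "q \<in> C" by blast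
        then have "u \<le> q" "q \<le> p" using u_le CA by (auto simp: A_def le_fun_def)
        then show ?thesis by (rule order_trans)
      qed
      ultimately show ?thesis using u_le by (auto simp: A_def le_fun_def intro!: bexI[of _ u])
    qed
  qed
  then show ?thesis unfolding A_def by (blast intro: order_trans)
qed

text \<open>For fixed \<open>a\<close> the infimum of \<open>q (y + t a) - t q a\<close> over \<open>t \<ge> 0\<close> is again a sublinear function of \<open>y\<close>
  below \<open>q\<close>, so by minimality it is \<open>q\<close>. Its term at \<open>t = 1\<close> then gives \<open>q y + q a \<le> q (y + a)\<close>, the
  reverse of subadditivity.\<close>

lemma minimal_sublinear_linear:
  assumes q: "sublinear q" and min: "\<And>r. sublinear r \<Longrightarrow> r \<le> q \<Longrightarrow> r = q"
  shows "linear q"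
proof -
  have super: "q x + q a \<le> q (x + a)" for x a
  proof -
    define r where "r y = (INF t\<in>{0..}. q (y + t *\<^sub>R a) - t * q a)" for y
    have lower: "- q (- y) \<le> q (y + t *\<^sub>R a) - t * q a" if "0 \<le> t" for y t
    proof -
      have "q (t *\<^sub>R a) = t * q a"
        using that sublinear_scale[OF q, of t a] sublinear_0[OF q] by (cases "t = 0") auto
      moreover have "q (t *\<^sub>R a) \<le> q (y + t *\<^sub>R a) + q (- y)"
        using sublinear_add[OF q, of "y + t *\<^sub>R a" "- y"] by simp
      ultimately show ?thesis by simp
    qed
    have r_le: "r y \<le> q (y + t *\<^sub>R a) - t * q a" if "0 \<le> t" for y t
      unfolding r_def using lower that by (intro cINF_lower bdd_belowI2[of _ "- q (- y)"]) auto
    have r_ge: "m \<le> r y" if "\<And>t. 0 \<le> t \<Longrightarrow> m \<le> q (y + t *\<^sub>R a) - t * q a" for m y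
      unfolding r_def using that by (intro cINF_greatest) auto
    have "sublinear r"
    proof (rule sublinearI)
      fix y z
      have *: "r (y + z) \<le> (q (y + t *\<^sub>R a) - t * q a) + (q (z + s *\<^sub>R a) - s * q a)"
        if "0 \<le> t" "0 \<le> s" for t s
        using r_le[of "t + s" "y + z"] sublinear_add[OF q, of "y + t *\<^sub>R a" "z + s *\<^sub>R a"] that
        by (simp add: algebra_simps)
      have "r (y + z) - (q (z + s *\<^sub>R a) - s * q a) \<le> r y" if "0 \<le> s" for s
        using *[OF _ that] by (intro r_ge) (simp add: algebra_simps)
      then have "r (y + z) - r y \<le> r z"
        by (intro r_ge) (smt (verit))
      then show "r (y + z) \<le> r y + r z" by simp
    next
      fix c :: real and y assume c: "0 < c"
      have "r (c *\<^sub>R y) / c \<le> r y"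
      proof (rule r_ge)
        fix t :: real assume t: "0 \<le> t"
        have "q (c *\<^sub>R y + (c * t) *\<^sub>R a) = c * q (y + t *\<^sub>R a)"
          using sublinear_scale[OF q c, of "y + t *\<^sub>R a"] by (simp add: algebra_simps)
        with r_le[of "c * t" "c *\<^sub>R y"] c t
        have "r (c *\<^sub>R y) \<le> c * (q (y + t *\<^sub>R a) - t * q a)" by (simp add: algebra_simps)
        then show "r (c *\<^sub>R y) / c \<le> q (y + t *\<^sub>R a) - t * q a"
          using c by (simp add: pos_divide_le_eq mult.commute)
      qed
      then show "r (c *\<^sub>R y) \<le> c * r y" using c by (simp add: pos_divide_le_eq mult.commute)
    qed
    moreover have "r \<le> q" using r_le[of 0] by (simp add: le_fun_def)
    ultimately have "r = q" by (rule min)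
    then show ?thesis using r_le[of 1 x] by simp
  qed
  have add: "q (x + y) = q x + q y" for x y
    using super[of x y] sublinear_add[OF q, of x y] by simp
  have neg: "q (- x) = - q x" for x using add[of x "- x"] sublinear_0[OF q] by simp
  have "q (c *\<^sub>R x) = c * q x" for c x
  proof (cases c "0 :: real" rule: linorder_cases)
    case less
    then show ?thesis using sublinear_scale[OF q, of "- c" x] neg[of "c *\<^sub>R x"] by simp
  qed (use sublinear_0[OF q] sublinear_scale[OF q] in auto)
  with add show ?thesis by (auto intro: linearI)
qed

text \<open>The Hahn-Banach theorem in a form that mentions no subspace: constraints are built into the
  choice of \<open>p\<close>.\<close>

lemma Hahn_Banach_sublinear:
  assumes "sublinear p"
  obtains l where "linear l" "\<And>x. l x \<le> p x"
proof -
  obtain q where q: "sublinear q" "q \<le> p" "\<And>r. sublinear r \<Longrightarrow> r \<le> q \<Longrightarrow> r = q"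
    using minimal_sublinear_exists[OF assms] by blast
  have "linear q" using q(1,3) by (rule minimal_sublinear_linear)
  with q(2) that show thesis by (auto simp: le_fun_def)
qed

text \<open>Let \<open>p h\<close> be the infimum of the slopes \<open>(f (e0 + t (h + k)) - v) / t\<close> over \<open>t > 0\<close> and \<open>k \<in> K\<close>.
  Convexity makes \<open>p\<close> subadditive. It is finite because \<open>e0\<close> is interior to \<open>T\<close> and \<open>v\<close> is a lower
  bound on \<open>e0 + K\<close>. Taking \<open>k = - h\<close> and \<open>t \<rightarrow> \<infinity>\<close> shows \<open>p \<le> 0\<close> on \<open>K\<close>, and \<open>t = 1\<close>, \<open>k = 0\<close> shows
  \<open>p h \<le> f (e0 + h) - v\<close>. A linear functional below \<open>p\<close> therefore vanishes on \<open>K\<close> and supports \<open>f\<close>; it is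
  bounded because \<open>f\<close> is bounded above near \<open>e0\<close>.\<close>

lemma affine_minorant_on_subspace_constraint:
  fixes f :: "'a::real_normed_vector \<Rightarrow> real"
  assumes T: "convex T" "e0 \<in> interior T" and f: "convex_on T f" "isCont f e0"
    and K: "subspace K" and v: "\<And>h. h \<in> K \<Longrightarrow> e0 + h \<in> T \<Longrightarrow> v \<le> f (e0 + h)"
  obtains l where "bounded_linear l" "\<And>h. h \<in> K \<Longrightarrow> l h = 0"
    "\<And>e. e \<in> T \<Longrightarrow> v + l (e - e0) \<le> f e"
proof -
  define R where "R h = {(f (e0 + t *\<^sub>R (h + k)) - v) / t | t k. 0 < t \<and> k \<in> K \<and> e0 + t *\<^sub>R (h + k) \<in> T}" for h
  define p where "p h = Inf (R h)" for h
  have RI: "(f (e0 + t *\<^sub>R (h + k)) - v) / t \<in> R h"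
    if "0 < t" "k \<in> K" "e0 + t *\<^sub>R (h + k) \<in> T" for t h k
    using that unfolding R_def by blast
  have K0: "0 \<in> K" using K by (rule subspace_0)
  obtain d where d: "d > 0" "ball e0 d \<subseteq> T"
    using T(2) by (auto simp: mem_interior)
  have ne: "R h \<noteq> {}" for h
  proof -
    define t where "t = d / (2 * (norm h + 1))"
    have t: "t > 0" unfolding t_def using d by (simp add: add_nonneg_pos)
    have "t * norm h < d"
      unfolding t_def using d by (simp add: field_simps add_pos_nonneg add_nonneg_pos)
    then have "e0 + t *\<^sub>R (h + 0) \<in> T"
      using d(2) t by (intro subsetD[OF d(2)]) (simp add: dist_norm)
    from RI[OF t K0 this] show ?thesis by blast
  qed
  have add: "\<exists>r\<in>R (h1 + h2). r \<le> r1 + r2" if r: "r1 \<in> R h1" "r2 \<in> R h2" for r1 r2 h1 h2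
  proof -
    from r obtain t k where 1: "r1 = (f (e0 + t *\<^sub>R (h1 + k)) - v) / t" "0 < t" "k \<in> K" "e0 + t *\<^sub>R (h1 + k) \<in> T"
      unfolding R_def by blast
    from r obtain s j where 2: "r2 = (f (e0 + s *\<^sub>R (h2 + j)) - v) / s" "0 < s" "j \<in> K" "e0 + s *\<^sub>R (h2 + j) \<in> T"
      unfolding R_def by blast
    \<comment> \<open>The weights are chosen so that both chords reach the same step length \<open>a\<close>.\<close>
    define u where "u = s / (s + t)"
    define a where "a = t * s / (s + t)"
    have u: "0 \<le> u" "u \<le> 1" "1 - u = t / (s + t)" using 1 2 by (auto simp: u_def field_simps)
    have a: "0 < a" "u * t = a" "(1 - u) * s = a" using 1 2 unfolding u by (auto simp: u_def a_def)
    have "u *\<^sub>R (e0 + t *\<^sub>R (h1 + k)) + (1 - u) *\<^sub>R (e0 + s *\<^sub>R (h2 + j))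
        = e0 + (u * t) *\<^sub>R (h1 + k) + ((1 - u) * s) *\<^sub>R (h2 + j)"
      by (simp add: algebra_simps)
    then have eq: "u *\<^sub>R (e0 + t *\<^sub>R (h1 + k)) + (1 - u) *\<^sub>R (e0 + s *\<^sub>R (h2 + j))
        = e0 + a *\<^sub>R ((h1 + h2) + (k + j))"
      unfolding a by (simp add: algebra_simps)
    have inT: "e0 + a *\<^sub>R ((h1 + h2) + (k + j)) \<in> T"
      unfolding eq[symmetric] using T(1) 1 2 u by (intro convexD) auto
    have "f (e0 + a *\<^sub>R ((h1 + h2) + (k + j)))
        \<le> u * f (e0 + t *\<^sub>R (h1 + k)) + (1 - u) * f (e0 + s *\<^sub>R (h2 + j))"
      unfolding eq[symmetric] using convex_onD[OF f(1), of "1 - u", OF _ _ 1(4) 2(4)] u(1,2) by simp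
    then have "f (e0 + a *\<^sub>R ((h1 + h2) + (k + j))) - v \<le> u * (t * r1) + (1 - u) * (s * r2)"
    proof -
      have "t * r1 = f (e0 + t *\<^sub>R (h1 + k)) - v" "s * r2 = f (e0 + s *\<^sub>R (h2 + j)) - v"
        using 1(1,2) 2(1,2) by simp_all
      then have "u * (t * r1) + (1 - u) * (s * r2)
          = u * f (e0 + t *\<^sub>R (h1 + k)) + (1 - u) * f (e0 + s *\<^sub>R (h2 + j)) - v"
        by (simp only:) (simp add: left_diff_distrib right_diff_distrib)
      then show ?thesis using \<open>f (e0 + a *\<^sub>R ((h1 + h2) + (k + j))) \<le> _\<close> by linarith
    qed
    also have "\<dots> = a * (r1 + r2)"
    proof -
      have "u * (t * r1) = a * r1" "(1 - u) * (s * r2) = a * r2" using a(2,3) by (simp_all flip: mult.assoc)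
      then show ?thesis by (simp only: distrib_left)
    qed
    finally have "(f (e0 + a *\<^sub>R ((h1 + h2) + (k + j))) - v) / a \<le> r1 + r2"
      using a by (simp add: pos_divide_le_eq mult.commute)
    moreover have "k + j \<in> K" using K 1 2 by (intro subspace_add)
    ultimately show ?thesis using RI[OF a(1) _ inT] by blast
  qed
  have nonneg: "0 \<le> r" if "r \<in> R 0" for r
    using that v K unfolding R_def by (auto simp: subspace_scale)
  have bdd: "bdd_below (R h)" for h
  proof -
    obtain r2 where r2: "r2 \<in> R (- h)" using ne by blast
    have "- r2 \<le> r" if "r \<in> R h" for r
    proof -
      from add[OF that r2] obtain r' where "r' \<in> R 0" "r' \<le> r + r2" by auto
      with nonneg[of r'] show ?thesis by simp
    qed
    then show ?thesis by (rule bdd_belowI)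
  qed
  have p_le: "p h \<le> r" if "r \<in> R h" for r h
    unfolding p_def using that bdd by (rule cInf_lower)
  have p_ge: "m \<le> p h" if "\<And>r. r \<in> R h \<Longrightarrow> m \<le> r" for m h
    unfolding p_def using ne that by (rule cInf_greatest)
  have "sublinear p"
  proof (rule sublinearI)
    fix x y
    have *: "p (x + y) \<le> r1 + r2" if "r1 \<in> R x" "r2 \<in> R y" for r1 r2
    proof -
      from add[OF that] obtain r where "r \<in> R (x + y)" "r \<le> r1 + r2" by auto
      with p_le[of r "x + y"] show ?thesis by simp
    qed
    have sub: "p (x + y) - r2 \<le> p x" if "r2 \<in> R y" for r2
      using *[OF _ that] by (intro p_ge) (simp add: algebra_simps)
    have "p (x + y) - p x \<le> r2" if "r2 \<in> R y" for r2 using sub[OF that] by simp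
    then have "p (x + y) - p x \<le> p y" by (rule p_ge)
    then show "p (x + y) \<le> p x + p y" by simp
  next
    fix c :: real and x assume c: "0 < c"
    have "p (c *\<^sub>R x) / c \<le> p x"
    proof (rule p_ge)
      fix r assume "r \<in> R x"
      then obtain t k where 1: "r = (f (e0 + t *\<^sub>R (x + k)) - v) / t" "0 < t" "k \<in> K" "e0 + t *\<^sub>R (x + k) \<in> T"
        unfolding R_def by blast
      have eq: "(t / c) *\<^sub>R (c *\<^sub>R x + c *\<^sub>R k) = t *\<^sub>R (x + k)" using c by (simp add: algebra_simps)
      have "(f (e0 + (t / c) *\<^sub>R (c *\<^sub>R x + c *\<^sub>R k)) - v) / (t / c) \<in> R (c *\<^sub>R x)"
        using 1 c K by (intro RI) (auto simp: eq subspace_scale)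
      from p_le[OF this] have "p (c *\<^sub>R x) \<le> c * r"
        unfolding eq 1(1) by (simp add: mult.commute)
      then show "p (c *\<^sub>R x) / c \<le> r" using c by (simp add: pos_divide_le_eq mult.commute)
    qed
    then show "p (c *\<^sub>R x) \<le> c * p x" using c by (simp add: pos_divide_le_eq mult.commute)
  qed
  then obtain l where l: "linear l" "\<And>x. l x \<le> p x" by (rule Hahn_Banach_sublinear) blast
  have e0T: "e0 \<in> T" using T(2) interior_subset by blast
  have l_le0: "l k \<le> 0" if k: "k \<in> K" for k
  proof (rule ccontr)
    assume "\<not> l k \<le> 0"
    have *: "l k \<le> (f e0 - v) / t" if "t > 0" for t
      using p_le[OF RI[of t "- k" k]] that subspace_neg[OF K k] e0T l(2)[of k] by simp
    from v[OF K0] e0T have "0 \<le> f e0 - v" by simp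
    \<comment> \<open>At this \<open>t\<close> the bound on \<open>l k\<close> fails by exactly 1 after clearing denominators.\<close>
    with \<open>\<not> l k \<le> 0\<close> have t: "(f e0 - v + 1) / l k > 0" by simp
    have "l k * (f e0 - v + 1) \<le> (f e0 - v) * l k"
      using *[OF t] t \<open>\<not> l k \<le> 0\<close> \<open>0 \<le> f e0 - v\<close> by (simp add: field_simps)
    with \<open>\<not> l k \<le> 0\<close> show False by (simp add: algebra_simps)
  qed
  have lK: "l k = 0" if k: "k \<in> K" for k
    using l_le0[OF k] l_le0[OF subspace_neg[OF K k]] l(1) by (simp add: linear_neg)
  have lT: "v + l (e - e0) \<le> f e" if "e \<in> T" for e
  proof -
    have "f e - v \<in> R (e - e0)" using RI[of 1 0 "e - e0"] that K0 by simp
    from p_le[OF this] l(2)[of "e - e0"] show ?thesis by simp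
  qed
  have "bounded_linear l"
  proof -
    obtain d' where d': "d' > 0" "\<And>x. dist x e0 < d' \<Longrightarrow> dist (f x) (f e0) < 1"
      using f(2)[unfolded continuous_at_eps_delta, rule_format, of 1] by auto
    define r where "r = min d d' / 2"
    define C where "C = f e0 + 1 - v"
    have r: "r > 0" "r < d" "r < d'" using d d' by (auto simp: r_def)
    have le: "l h \<le> C" if "norm h \<le> r" for h
    proof -
      have "e0 + h \<in> T" using that r d by (auto simp: dist_norm)
      then have "l h \<le> f (e0 + h) - v" using lT[of "e0 + h"] by simp
      moreover have "f (e0 + h) < f e0 + 1" using d'(2)[of "e0 + h"] that r by (simp add: dist_norm abs_less_iff)
      ultimately show ?thesis by (simp add: C_def)
    qed
    have "norm (l x) \<le> norm x * (C / r)" for x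
    proof (cases "x = 0")
      case False
      define c where "c = r / norm x"
      have c: "c > 0" using r False by (simp add: c_def)
      have n: "norm (c *\<^sub>R x) \<le> r" using r False by (simp add: c_def)
      have "\<bar>l (c *\<^sub>R x)\<bar> \<le> C"
        using le[OF n] le[of "- (c *\<^sub>R x)"] n l(1) by (simp add: linear_neg abs_le_iff)
      then have "c * \<bar>l x\<bar> \<le> C" using l(1) c by (simp add: linear_cmul abs_mult)
      then show ?thesis using r False by (simp add: c_def field_simps)
    qed (use l(1) in \<open>simp add: linear_0\<close>)
    with l(1) show ?thesis
      by (intro bounded_linear_intro[where K = "C / r"]) (auto simp: linear_add linear_cmul)
  qed
  with lK lT that show thesis by blast
qed

text \<open>Passing from \<open>S\<close> to the kernel of the first functional in \<open>S\<close> shortens the list, and a vector of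
  \<open>S\<close> at which the first functional is 1 determines its coefficient.\<close>

lemma functional_vanishing_on_common_kernel:
  fixes l :: "'a::real_vector \<Rightarrow> real"
  assumes "linear l" "subspace S" "\<And>a. a \<in> set as \<Longrightarrow> linear (F a)"
    "\<And>x. x \<in> S \<Longrightarrow> (\<And>a. a \<in> set as \<Longrightarrow> F a x = 0) \<Longrightarrow> l x = 0"
  shows "\<exists>c. \<forall>x\<in>S. l x = (\<Sum>i<length as. c i * F (as ! i) x)"
  using assms(2-4)
proof (induction as arbitrary: S)
  case Nil
  then show ?case by auto
next
  case (Cons a as)
  have lin: "linear (F a)" "\<And>b. b \<in> set as \<Longrightarrow> linear (F b)" using Cons.prems by auto
  have S': "subspace {x \<in> S. F a x = 0}"
    using Cons.prems(1) lin(1)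
    by (auto simp: subspace_def linear_0 linear_add linear_cmul)
  obtain c where c: "\<And>x. x \<in> S \<Longrightarrow> F a x = 0 \<Longrightarrow> l x = (\<Sum>i<length as. c i * F (as ! i) x)"
    using Cons.IH[OF S' lin(2)] Cons.prems(3) by auto
  show ?case
  proof (cases "\<forall>x\<in>S. F a x = 0")
    case True
    then have "\<forall>x\<in>S. l x = (\<Sum>i<length (a # as). (case_nat 0 c) i * F ((a # as) ! i) x)"
      using c by (simp add: sum.lessThan_Suc_shift del: sum.lessThan_Suc)
    then show ?thesis by blast
  next
    case False
    then obtain x1 where x1: "x1 \<in> S" "F a x1 \<noteq> 0" by blast
    define x0 where "x0 = inverse (F a x1) *\<^sub>R x1"
    have x0: "x0 \<in> S" "F a x0 = 1"
      using x1 Cons.prems(1) lin(1) by (auto simp: x0_def subspace_scale linear_cmul)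
    define G where "G x = (\<Sum>i<length as. c i * F (as ! i) x)" for x
    have G: "linear G"
    proof (rule linearI)
      have in_set: "linear (F (as ! i))" if "i < length as" for i using lin(2) that by simp
      show "G (x + y) = G x + G y" for x y
        using in_set by (simp add: G_def linear_add distrib_left sum.distrib)
      show "G (r *\<^sub>R x) = r *\<^sub>R G x" for r x
        using in_set by (simp add: G_def linear_cmul sum_distrib_left mult.left_commute)
    qed
    have "l x = (l x0 - G x0) * F a x + G x" if x: "x \<in> S" for x
    proof -
      have "x - F a x *\<^sub>R x0 \<in> S" using x x0 Cons.prems(1) by (intro subspace_diff subspace_scale)
      moreover have "F a (x - F a x *\<^sub>R x0) = 0" using x0 lin(1) by (simp add: linear_diff linear_cmul)
      ultimately have "l (x - F a x *\<^sub>R x0) = G (x - F a x *\<^sub>R x0)" unfolding G_def by (rule c)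
      then show ?thesis using assms(1) G by (simp add: linear_diff linear_cmul algebra_simps)
    qed
    then have "\<forall>x\<in>S. l x = (\<Sum>i<length (a # as). (case_nat (l x0 - G x0) c) i * F ((a # as) ! i) x)"
      by (simp add: sum.lessThan_Suc_shift G_def del: sum.lessThan_Suc)
    then show ?thesis by blast
  qed
qed

section \<open>Integration against a density and a point mass\<close>

text \<open>The supremum over the measurable subsets of \<open>E\<close> is attained at the part of \<open>E\<close> on which \<open>h\<close> is
  positive. The coercion into the extended nonnegative reals turns \<open>h\<close> into its positive part.\<close>

lemma upper_var_eq_density:
  assumes sets: "sets m = sets half_borel" and h: "integrable m h"
    and \<mu>: "\<And>E. E \<in> sets half_borel \<Longrightarrow> smeas \<mu> E = (\<integral>x. indicator E x * h x \<partial>m)"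
  shows "upper_var \<mu> = density m (\<lambda>x. ennreal (h x))"
proof -
  have space: "space m = {0..}" using sets_eq_imp_space_eq[OF sets] by (simp add: space_restrict_space)
  have [measurable]: "h \<in> borel_measurable m" using h by simp
  have hp: "integrable m (\<lambda>x. max 0 (h x))" using h by simp
  have int: "integrable m (\<lambda>x. indicator F x * g x)" if "F \<in> sets m" "integrable m g" for F and g :: "real \<Rightarrow> real"
    using integrable_mult_indicator[OF that] by simp
  have mass: "emeasure (density m (\<lambda>x. ennreal (h x))) F = ennreal (\<integral>x. indicator F x * max 0 (h x) \<partial>m)"
    if F: "F \<in> sets m" for F
  proof -
    have "emeasure (density m (\<lambda>x. ennreal (h x))) F = (\<integral>\<^sup>+x. ennreal (h x) * indicator F x \<partial>m)"
      using F by (subst emeasure_density) auto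
    also have "\<dots> = (\<integral>\<^sup>+x. ennreal (indicator F x * max 0 (h x)) \<partial>m)"
      by (intro nn_integral_cong) (auto simp: indicator_def max_def ennreal_neg)
    also have "\<dots> = ennreal (\<integral>x. indicator F x * max 0 (h x) \<partial>m)"
      by (intro nn_integral_eq_integral int F hp) auto
    finally show ?thesis .
  qed
  have SUP: "(SUP F\<in>{F \<in> sets half_borel. F \<subseteq> E}. ennreal (smeas \<mu> F))
      = emeasure (density m (\<lambda>x. ennreal (h x))) E" if E: "E \<in> sets half_borel" for E
  proof (rule antisym)
    show "(SUP F\<in>{F \<in> sets half_borel. F \<subseteq> E}. ennreal (smeas \<mu> F))
        \<le> emeasure (density m (\<lambda>x. ennreal (h x))) E"
    proof (rule SUP_least)
      fix F assume F: "F \<in> {F \<in> sets half_borel. F \<subseteq> E}"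
      have "ennreal (smeas \<mu> F) \<le> emeasure (density m (\<lambda>x. ennreal (h x))) F"
        using F sets by (subst \<mu>) (auto simp: mass intro!: ennreal_leI integral_mono int h hp mult_left_mono)
      also have "\<dots> \<le> emeasure (density m (\<lambda>x. ennreal (h x))) E"
        using F E sets by (intro emeasure_mono) auto
      finally show "ennreal (smeas \<mu> F) \<le> emeasure (density m (\<lambda>x. ennreal (h x))) E" .
    qed
  next
    define F where "F = {x \<in> space m. 0 < h x} \<inter> E"
    have F: "F \<in> sets m" unfolding F_def using E unfolding sets[symmetric] by measurable
    have "emeasure (density m (\<lambda>x. ennreal (h x))) E = ennreal (\<integral>x. indicator E x * max 0 (h x) \<partial>m)"
      using E sets by (simp add: mass)
    also have "(\<integral>x. indicator E x * max 0 (h x) \<partial>m) = (\<integral>x. indicator F x * h x \<partial>m)"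
      by (intro Bochner_Integration.integral_cong) (auto simp: F_def indicator_def)
    also have "\<dots> = smeas \<mu> F" using F sets by (simp add: \<mu>)
    finally show "emeasure (density m (\<lambda>x. ennreal (h x))) E
        \<le> (SUP F\<in>{F \<in> sets half_borel. F \<subseteq> E}. ennreal (smeas \<mu> F))"
      using F sets by (auto simp: F_def intro!: SUP_upper)
  qed
  have "upper_var \<mu> = measure_of (space m) (sets m) (emeasure (density m (\<lambda>x. ennreal (h x))))"
    unfolding upper_var_def space sets
  proof (rule measure_of_eq)
    show "sets half_borel \<subseteq> Pow {0..}" by (auto simp: sets_restrict_space)
    fix E assume "E \<in> sigma_sets {0..} (sets half_borel)"
    then have "E \<in> sets half_borel"
      using sets.sigma_sets_eq[of half_borel] by (simp add: space_restrict_space)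
    then show "(SUP F\<in>{F \<in> sets half_borel. F \<subseteq> E}. ennreal (smeas \<mu> F))
      = emeasure (density m (\<lambda>x. ennreal (h x))) E" by (rule SUP)
  qed
  also have "\<dots> = density m (\<lambda>x. ennreal (h x))"
    using measure_of_of_measure[of "density m (\<lambda>x. ennreal (h x))"] by simp
  finally show ?thesis .
qed

lemma ev_borel [measurable]: "ev e \<in> borel_measurable borel"
proof -
  have "(\<lambda>x. indicator {0..} x *\<^sub>R ev e x) \<in> borel_measurable borel"
    by (rule borel_measurable_continuous_on_indicator) (auto simp: continuous_on_ev)
  moreover have "(\<lambda>x. indicator {0..} x *\<^sub>R ev e x) = ev e"
    by (auto simp: fun_eq_iff indicator_def ev_neg)
  ultimately show ?thesis by simp
qed

text \<open>The upper variations of \<open>\<mu>\<close> and \<open>- \<mu>\<close> have the positive and the negative part of \<open>h\<close> as densities,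
  and the difference of the two parts is \<open>h\<close>.\<close>

lemma pairing_eq_integral:
  assumes sets: "sets m = sets half_borel" and h: "integrable m h"
    and \<mu>: "\<And>E. E \<in> sets half_borel \<Longrightarrow> smeas \<mu> E = (\<integral>x. indicator E x * h x \<partial>m)"
  shows "pairing \<mu> e = (\<integral>x. h x * ev e x \<partial>m)"
proof -
  have [measurable]: "h \<in> borel_measurable m" using h by simp
  have e [measurable]: "ev e \<in> borel_measurable m"
    using measurable_restrict_space1[OF ev_borel[of e], of "{0..}"]
    by (simp add: measurable_cong_sets[OF sets refl])
  have int: "integrable m (\<lambda>x. g x * ev e x)" if g: "integrable m g" for g
  proof (rule Bochner_Integration.integrable_bound)
    show "integrable m (\<lambda>x. norm e * g x)" using g by simp
    show "(\<lambda>x. g x * ev e x) \<in> borel_measurable m" using borel_measurable_integrable[OF g] by measurable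
    show "AE x in m. norm (g x * ev e x) \<le> norm (norm e * g x)"
    proof (rule AE_I2)
      show "norm (g x * ev e x) \<le> norm (norm e * g x)" for x
        using mult_left_mono[OF abs_ev_le_norm[of e x], of "\<bar>g x\<bar>"] by (simp add: abs_mult mult.commute)
    qed
  qed
  have upper: "integral\<^sup>L (upper_var \<nu>) (ev e) = (\<integral>x. max 0 (g x) * ev e x \<partial>m)"
    if g: "integrable m g"
      and \<nu>: "\<And>E. E \<in> sets half_borel \<Longrightarrow> smeas \<nu> E = (\<integral>x. indicator E x * g x \<partial>m)" for \<nu> g
  proof -
    have [measurable]: "g \<in> borel_measurable m" using g by simp
    have "upper_var \<nu> = density m (\<lambda>x. ennreal (max 0 (g x)))"
    proof -
      have "(\<lambda>x. ennreal (g x)) = (\<lambda>x. ennreal (max 0 (g x)))"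
        by (auto simp: fun_eq_iff max_def ennreal_neg)
      with upper_var_eq_density[OF sets g \<nu>] show ?thesis by simp
    qed
    then show ?thesis by (simp add: integral_density)
  qed
  have "smeas (- \<mu>) E = (\<integral>x. indicator E x * (- h x) \<partial>m)" if "E \<in> sets half_borel" for E
    using that by (simp add: uminus_smeasure.rep_eq \<mu>)
  then have "pairing \<mu> e = (\<integral>x. max 0 (h x) * ev e x \<partial>m) - (\<integral>x. max 0 (- h x) * ev e x \<partial>m)"
    unfolding pairing_def using h \<mu> by (subst (1 2) upper) auto
  also have "\<dots> = (\<integral>x. max 0 (h x) * ev e x - max 0 (- h x) * ev e x \<partial>m)"
    using h by (intro Bochner_Integration.integral_diff[symmetric] int) auto
  also have "\<dots> = (\<integral>x. h x * ev e x \<partial>m)"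
    by (intro Bochner_Integration.integral_cong) (auto simp: max_def)
  finally show ?thesis .
qed

text \<open>Lebesgue measure on the half-line plus a unit mass at 0: the map collapses an interval of
  length 1 to the point 0. With respect to this measure the sum of an absolutely continuous measure
  and a multiple of the Dirac measure has a density.\<close>

definition leb_dirac :: "real measure" where
  "leb_dirac = distr (restrict_space lborel {-1..}) half_borel (\<lambda>t. max 0 t)"

lemma leb_dirac_integral:
  fixes f :: "real \<Rightarrow> real"
  assumes f: "f \<in> borel_measurable borel" "set_integrable lborel {0..} f"
  shows "integrable leb_dirac f" "(\<integral>t. f t \<partial>leb_dirac) = f 0 + (LINT t:{0..}|lborel. f t)"
proof -
  note [measurable] = f(1)
  have proj: "(\<lambda>t. max 0 t) \<in> measurable (restrict_space lborel {-1..}) half_borel"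
    by (intro measurable_restrict_space2 measurable_restrict_space1) auto
  have fh: "f \<in> borel_measurable half_borel" by (intro measurable_restrict_space1 f)
  have split: "indicator {-1..} t * f (max 0 t) = indicator {-1..<0} t * f 0 + indicator {0..} t * f t" for t
    by (auto simp: indicator_def max_def)
  have i1: "integrable lborel (\<lambda>t. indicator {-1..<0::real} t * f 0)" by simp
  have i2: "integrable lborel (\<lambda>t. indicator {0..} t * f t)"
    using f(2) by (simp add: set_integrable_def)
  show "integrable leb_dirac f"
    unfolding leb_dirac_def
    unfolding integrable_distr_eq[OF proj fh]
    using Bochner_Integration.integrable_add[OF i1 i2]
    by (subst integrable_restrict_space) (simp_all add: split)
  have "(\<integral>t. f t \<partial>leb_dirac) = (\<integral>t. indicator {-1..<0} t * f 0 + indicator {0..} t * f t \<partial>lborel)"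
    unfolding leb_dirac_def integral_distr[OF proj fh]
    by (subst integral_restrict_space) (auto simp: split)
  also have "\<dots> = f 0 + (LINT t:{0..}|lborel. f t)"
    using i1 i2 by (subst Bochner_Integration.integral_add) (auto simp: set_lebesgue_integral_def)
  finally show "(\<integral>t. f t \<partial>leb_dirac) = f 0 + (LINT t:{0..}|lborel. f t)" .
qed

lemma pairing_dens_delta0:
  assumes g: "set_integrable lborel {0..} g"
  shows "pairing (dens g + l *\<^sub>R delta0) e = ip (ev e) g + l * ev e 0"
proof -
  \<comment> \<open>The density with respect to \<open>leb_dirac\<close>; Lebesgue integrals do not see its value at 0.\<close>
  define h where "h t = (if t = 0 then l else indicator {0..} t * g t)" for t
  have g0 [measurable]: "(\<lambda>t. indicator {0..} t * g t) \<in> borel_measurable borel"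
    using g by (auto simp: set_integrable_def dest!: borel_measurable_integrable)
  have h [measurable]: "h \<in> borel_measurable borel" unfolding h_def by measurable
  have eq: "AE t in lborel. indicator {0..} t * (u t * g t) = indicator {0..} t *\<^sub>R (u t * h t)" for u :: "real \<Rightarrow> real"
    using AE_lborel_singleton[of "0::real"] by eventually_elim (auto simp: h_def indicator_def)
  have int: "set_integrable lborel {0..} (\<lambda>t. u t * h t)"
     "(LINT t:{0..}|lborel. u t * h t) = (LINT t:{0..}|lborel. u t * g t)"
    if u[measurable]: "u \<in> borel_measurable borel" and B: "\<And>t. \<bar>u t\<bar> \<le> B" for u B
  proof -
    have "integrable lborel (\<lambda>t. indicator {0..} t * (u t * g t))"
    proof (rule Bochner_Integration.integrable_bound)
      show "integrable lborel (\<lambda>t. B * (indicator {0..} t * g t))"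
        using g by (simp add: set_integrable_def)
      have "(\<lambda>t. u t * (indicator {0..} t * g t)) \<in> borel_measurable lborel" by measurable
      then show "(\<lambda>t. indicator {0..} t * (u t * g t)) \<in> borel_measurable lborel"
        by (simp add: algebra_simps)
      show "AE t in lborel. norm (indicator {0..} t * (u t * g t)) \<le> norm (B * (indicator {0..} t * g t))"
      proof (rule AE_I2)
        fix t
        have "\<bar>u t\<bar> \<le> \<bar>B\<bar>" using B[of t] by simp
        then show "norm (indicator {0..} t * (u t * g t)) \<le> norm (B * (indicator {0..} t * g t))"
          by (auto simp: abs_mult indicator_def intro!: mult_right_mono)
      qed
    qed
    note uh = this
    have m: "(\<lambda>t. indicator {0..} t *\<^sub>R (u t * h t)) \<in> borel_measurable lborel" by measurable
    have m0: "(\<lambda>t. indicator {0..} t * (u t * g t)) \<in> borel_measurable lborel"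
      using borel_measurable_integrable[OF uh] .
    show "set_integrable lborel {0..} (\<lambda>t. u t * h t)"
      unfolding set_integrable_def using integrable_cong_AE[OF m0 m eq] uh by simp
    show "(LINT t:{0..}|lborel. u t * h t) = (LINT t:{0..}|lborel. u t * g t)"
      unfolding set_lebesgue_integral_def
      using integral_cong_AE[OF m0 m eq] by simp
  qed
  have hint: "integrable leb_dirac h"
    using int(1)[of "\<lambda>_. 1" 1] by (intro leb_dirac_integral) auto
  have "smeas (dens g + l *\<^sub>R delta0) E = (\<integral>t. indicator E t * h t \<partial>leb_dirac)"
    if E: "E \<in> sets half_borel" for E
  proof -
    have Eb[measurable]: "E \<in> sets borel" and E0: "E \<subseteq> {0..}" using E by (auto simp: sets_restrict_space)
    have "(\<integral>t. indicator E t * h t \<partial>leb_dirac) = indicator E 0 * h 0 + (LINT t:{0..}|lborel. indicator E t * h t)"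
      using int(1)[of "indicator E" 1] by (intro leb_dirac_integral) auto
    also have "(LINT t:{0..}|lborel. indicator E t * h t) = (LINT t:{0..}|lborel. indicator E t * g t)"
      by (rule int(2)[of _ 1]) auto
    also have "\<dots> = (LINT t:E|lborel. g t)"
      unfolding set_lebesgue_integral_def using E0
      by (intro Bochner_Integration.integral_cong) (auto simp: indicator_def)
    finally show ?thesis
      using E g by (simp add: plus_smeasure.rep_eq scaleR_smeasure.rep_eq dens.rep_eq delta0.rep_eq h_def)
  qed
  then have "pairing (dens g + l *\<^sub>R delta0) e = (\<integral>t. h t * ev e t \<partial>leb_dirac)"
    using hint by (intro pairing_eq_integral) (auto simp: leb_dirac_def)
  also have "\<dots> = (\<integral>t. ev e t * h t \<partial>leb_dirac)" by (simp add: mult.commute)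
  also have "\<dots> = ev e 0 * h 0 + (LINT t:{0..}|lborel. ev e t * h t)"
    using int(1)[OF ev_borel abs_ev_le_norm] by (intro leb_dirac_integral) auto
  also have "\<dots> = ip (ev e) g + l * ev e 0"
    unfolding ip_def int(2)[OF ev_borel abs_ev_le_norm] by (simp add: h_def)
  finally show ?thesis .
qed

lemma pairing_dens: "set_integrable lborel {0..} g \<Longrightarrow> pairing (dens g) e = ip (ev e) g"
  using pairing_dens_delta0[of g 0 e] by simp

section \<open>Laplace transforms of exponential polynomials\<close>

lemma set_integrable_exp_minus:
  fixes a :: real
  assumes "0 < a"
  shows "set_integrable lborel {0..} (\<lambda>t. exp (- a * t))"
    and "(LINT t:{0..}|lborel. exp (- a * t)) = 1 / a"
proof -
  have i: "((\<lambda>t. exp (- a * t)) has_integral 1 / a) {0..}"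
    using has_integral_exp_minus_to_infinity[OF assms, of 0] by simp
  then have "(\<lambda>t. exp (- a * t)) absolutely_integrable_on {0..}"
    by (intro nonnegative_absolutely_integrable_1) (auto simp: integrable_on_def)
  then show s: "set_integrable lborel {0..} (\<lambda>t. exp (- a * t))"
    unfolding set_integrable_def by (subst (asm) integrable_completion) auto
  show "(LINT t:{0..}|lborel. exp (- a * t)) = 1 / a"
    using set_borel_integral_eq_integral(2)[OF s] i by (simp add: integral_unique)
qed

lemma set_integrable_exp_bounded:
  fixes z :: complex
  assumes z: "0 < Re z" and [measurable]: "u \<in> borel_measurable borel"
    and B: "\<And>t. 0 \<le> t \<Longrightarrow> \<bar>u t\<bar> \<le> B"
  shows "set_integrable lborel {0..} (\<lambda>t. exp (- z * of_real t) * of_real (u t))"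
  unfolding set_integrable_def
proof (rule Bochner_Integration.integrable_bound)
  show "integrable lborel (\<lambda>t. B * (indicator {0..} t *\<^sub>R exp (- Re z * t)))"
    using set_integrable_exp_minus(1)[OF z] by (simp add: set_integrable_def)
  show "(\<lambda>t. indicator {0..} t *\<^sub>R (exp (- z * of_real t) * of_real (u t))) \<in> borel_measurable lborel"
    by measurable
  show "AE t in lborel. norm (indicator {0..} t *\<^sub>R (exp (- z * of_real t) * of_real (u t)))
      \<le> norm (B * (indicator {0..} t *\<^sub>R exp (- Re z * t)))"
  proof (rule AE_I2)
    fix t :: real
    have "\<bar>u t\<bar> * exp (- Re z * t) \<le> \<bar>B * exp (- Re z * t)\<bar>" if "0 \<le> t"
      using B[OF that] by (simp add: abs_mult)
    then show "norm (indicator {0..} t *\<^sub>R (exp (- z * of_real t) * of_real (u t)))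
      \<le> norm (B * (indicator {0..} t *\<^sub>R exp (- Re z * t)))"
      by (auto simp: indicator_def norm_mult mult.commute)
  qed
qed

lemma laplace_one:
  assumes z: "0 < Re z"
  shows "laplace (\<lambda>_. 1) z = 1 / z"
proof -
  have z0: "z \<noteq> 0" using z by auto
  have i: "set_integrable lborel {0..} (\<lambda>t. exp (- z * of_real t))"
    using set_integrable_exp_bounded[OF z, of "\<lambda>_. 1" 1] by simp
  have i': "set_integrable lborel (einterval 0 \<infinity>) (\<lambda>t. exp (- z * of_real t))"
    by (rule set_integrable_subset[OF i]) (auto simp: einterval_def zero_ereal_def)
  have deriv: "((\<lambda>t. - exp (- z * of_real t) / z) has_vector_derivative exp (- z * of_real t)) (at t)" for t
  proof -
    have "((\<lambda>x. - exp (- z * x) / z) has_field_derivative exp (- z * of_real t)) (at (of_real t))"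
      by (rule derivative_eq_intros refl | use z0 in simp)+
    from has_vector_derivative_real_field[OF this] show ?thesis by simp
  qed
  have lim: "((\<lambda>t. - exp (- z * of_real t) / z) \<longlongrightarrow> 0) at_top"
  proof (rule tendsto_norm_zero_cancel)
    have "((\<lambda>t. exp (- Re z * t)) \<longlongrightarrow> 0) at_top"
      by (intro filterlim_compose[OF exp_at_bot] filterlim_tendsto_neg_mult_at_bot[OF tendsto_const] filterlim_ident)
         (use z in auto)
    then have "((\<lambda>t. exp (- Re z * t) / norm z) \<longlongrightarrow> 0 / norm z) at_top"
      by (intro tendsto_divide tendsto_const) (use z0 in auto)
    then show "((\<lambda>t. norm (- exp (- z * of_real t) / z)) \<longlongrightarrow> 0) at_top"
      by (simp add: norm_divide norm_exp)
  qed
  have "(LBINT t=0..\<infinity>. exp (- z * of_real t)) = 0 - (- 1 / z)"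
  proof (rule interval_integral_FTC_integrable[where F = "\<lambda>t. - exp (- z * of_real t) / z"])
    show "((\<lambda>t. - exp (- z * of_real t) / z) has_vector_derivative exp (- z * of_real t)) (at t)" for t
      by (rule deriv)
    show "set_integrable lborel (einterval 0 \<infinity>) (\<lambda>t. exp (- z * of_real t))" by (rule i')
    have "((\<lambda>t. - exp (- z * of_real t) / z) \<longlongrightarrow> - exp (- z * of_real 0) / z) (at_right 0)"
      by (intro tendsto_intros) (use z0 in auto)
    then show "(((\<lambda>t. - exp (- z * of_real t) / z) \<circ> real_of_ereal) \<longlongrightarrow> - 1 / z) (at_right 0)"
      unfolding zero_ereal_def ereal_tendsto_simps by simp
    show "(((\<lambda>t. - exp (- z * of_real t) / z) \<circ> real_of_ereal) \<longlongrightarrow> 0) (at_left \<infinity>)"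
      using lim by (simp add: ereal_tendsto_simps)
  qed (auto intro!: continuous_intros)
  moreover have "(LBINT t=0..\<infinity>. exp (- z * of_real t)) = (LBINT t:{0<..}. exp (- z * of_real t))"
    using interval_integral_to_infinity_eq[of lborel 0 "\<lambda>t. exp (- z * of_real t)"] by (simp add: zero_ereal_def)
  moreover have "(LBINT t:{0<..}. exp (- z * of_real t)) = (LBINT t:{0..}. exp (- z * of_real t))"
    unfolding set_lebesgue_integral_def
    by (rule integral_cong_AE) (use AE_lborel_singleton[of "0::real"] in \<open>auto elim!: eventually_mono simp: indicator_def\<close>)
  ultimately show ?thesis by (simp add: laplace_def)
qed

text \<open>Multiplication by \<open>1 - exp (- t)\<close> turns a transform \<open>F z\<close> into \<open>F z - F (z + 1)\<close>, and the
  denominators at \<open>z\<close> and \<open>z + 1\<close> share all but one factor each.\<close>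

lemma laplace_one_minus_exp_power:
  assumes z: "0 < Re z"
  shows "laplace (\<lambda>t. (1 - exp (- t)) ^ n) z = fact n / (\<Prod>j\<le>n. z + of_nat j)"
  using z
proof (induction n arbitrary: z)
  case 0
  then show ?case by (simp add: laplace_one)
next
  case (Suc n)
  have int: "set_integrable lborel {0..} (\<lambda>t. exp (- u * of_real t) * of_real ((1 - exp (- t)) ^ n))"
    if "0 < Re u" for u
  proof (rule set_integrable_exp_bounded[OF that, where B = 1])
    show "\<bar>(1 - exp (- t)) ^ n\<bar> \<le> 1" if "0 \<le> t" for t :: real
      using that by (simp add: power_abs power_le_one)
  qed measurable
  have z1: "0 < Re (z + 1)" using Suc.prems by simp
  have "exp (- z * of_real t) * of_real ((1 - exp (- t)) ^ Suc n)
      = exp (- z * of_real t) * of_real ((1 - exp (- t)) ^ n)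
        - exp (- (z + 1) * of_real t) * of_real ((1 - exp (- t)) ^ n)" for t :: real
  proof -
    have "exp (- (z + 1) * of_real t) = exp (- z * of_real t) * of_real (exp (- t))"
      by (simp add: exp_of_real[symmetric] exp_add[symmetric] algebra_simps)
    then show ?thesis by (simp add: algebra_simps)
  qed
  then have "laplace (\<lambda>t. (1 - exp (- t)) ^ Suc n) z
      = laplace (\<lambda>t. (1 - exp (- t)) ^ n) z - laplace (\<lambda>t. (1 - exp (- t)) ^ n) (z + 1)"
    unfolding laplace_def set_integral_diff(2)[OF int[OF Suc.prems] int[OF z1], symmetric] by simp
  also have "\<dots> = fact n / (\<Prod>j\<le>n. z + of_nat j) - fact n / (\<Prod>j\<le>n. (z + 1) + of_nat j)"
    using Suc.IH[OF Suc.prems] Suc.IH[OF z1] by simp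
  also have "\<dots> = fact (Suc n) / (\<Prod>j\<le>Suc n. z + of_nat j)"
  proof -
    \<comment> \<open>The factors that both denominators share.\<close>
    define Q where "Q = (\<Prod>j<n. z + 1 + of_nat j)"
    have nz: "z + of_nat j \<noteq> 0" for j
    proof
      assume "z + of_nat j = 0"
      then have "Re z + real j = 0" by (metis Re_complex_of_real complex_Re_of_nat plus_complex.sel(1) zero_complex.sel(1))
      with Suc.prems show False by simp
    qed
    have nz0: "z \<noteq> 0" and nzn: "z + 1 + of_nat n \<noteq> 0" using nz[of 0] nz[of "Suc n"] by (simp_all add: add_ac)
    have Q0: "Q \<noteq> 0" using nz[of "Suc _"] by (auto simp: Q_def add_ac)
    have 1: "(\<Prod>j\<le>n. z + of_nat j) = z * Q"
      by (simp add: Q_def prod.atMost_shift add_ac)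
    have 2: "(\<Prod>j\<le>n. (z + 1) + of_nat j) = Q * (z + 1 + of_nat n)"
      by (simp add: Q_def flip: lessThan_Suc_atMost)
    have 3: "(\<Prod>j\<le>Suc n. z + of_nat j) = z * Q * (z + 1 + of_nat n)"
      using 1 by (simp add: add_ac)
    show ?thesis
    proof -
      define y where "y = z + 1 + of_nat n"
      have "fact n / (z * Q) - fact n / (Q * y) = fact n * (y - z) / (z * Q * y)"
        using nz0 nzn Q0 by (simp add: y_def[symmetric] divide_simps) (simp add: algebra_simps)
      also have "fact n * (y - z) = fact (Suc n)" by (simp add: y_def algebra_simps)
      finally show ?thesis unfolding 1 2 3 y_def .
    qed
  qed
  finally show ?case .
qed

lemma laplace_exp_shift: "laplace (\<lambda>t. exp (- a * t) * u t) s = laplace u (s + of_real a)"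
  unfolding laplace_def
  by (rule arg_cong[where f = "set_lebesgue_integral lborel {0..}"])
     (auto simp: fun_eq_iff exp_of_real[symmetric] algebra_simps exp_add[symmetric] simp flip: mult.assoc)

section \<open>Zeros at infinity\<close>

lemma zero_at_inf_geI:
  assumes "q \<noteq> 0" "\<And>s. \<sigma> < Re s \<Longrightarrow> F s = poly p s / poly q s" "p = 0 \<or> degree p + k \<le> degree q"
  shows "zero_at_inf_ge F k"
  using assms unfolding zero_at_inf_ge_def is_rational_def by blast

lemma zero_at_inf_geE:
  assumes "zero_at_inf_ge F k"
  obtains p q \<sigma> where "q \<noteq> 0" "\<And>s. \<sigma> < Re s \<Longrightarrow> F s = poly p s / poly q s" "p = 0 \<or> degree p + k \<le> degree q"
  using assms unfolding zero_at_inf_ge_def is_rational_def by blast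

lemma zero_at_inf_ge_cong:
  assumes F: "zero_at_inf_ge F k" and eq: "\<And>s. \<tau> < Re s \<Longrightarrow> G s = F s"
  shows "zero_at_inf_ge G k"
proof -
  obtain p q \<sigma> where "q \<noteq> 0" "\<And>s. \<sigma> < Re s \<Longrightarrow> F s = poly p s / poly q s" "p = 0 \<or> degree p + k \<le> degree q"
    using F by (rule zero_at_inf_geE) blast
  then show ?thesis
    by (intro zero_at_inf_geI[of q "max \<sigma> \<tau>" G p]) (auto simp: eq)
qed

lemma zero_at_inf_ge_zero: "zero_at_inf_ge (\<lambda>_. 0) k"
  by (rule zero_at_inf_geI[of 1 0 _ 0]) auto

lemma zero_at_inf_ge_mono: "zero_at_inf_ge F k \<Longrightarrow> j \<le> k \<Longrightarrow> zero_at_inf_ge F j"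
  unfolding zero_at_inf_ge_def by fastforce

lemma zero_at_inf_ge_cmult:
  assumes "zero_at_inf_ge F k"
  shows "zero_at_inf_ge (\<lambda>s. c * F s) k"
proof -
  obtain p q \<sigma> where "q \<noteq> 0" "\<And>s. \<sigma> < Re s \<Longrightarrow> F s = poly p s / poly q s" "p = 0 \<or> degree p + k \<le> degree q"
    using assms by (rule zero_at_inf_geE) blast
  then show ?thesis
    by (intro zero_at_inf_geI[of q \<sigma> _ "smult c p"]) auto
qed

text \<open>Fractions are added only to the right of all zeros of the two denominators, where their values
  are genuine quotients.\<close>

lemma zero_at_inf_ge_add:
  assumes F: "zero_at_inf_ge F k" and G: "zero_at_inf_ge G k"
  shows "zero_at_inf_ge (\<lambda>s. F s + G s) k"
proof -
  obtain p q \<sigma> where 1: "q \<noteq> 0" "\<And>s. \<sigma> < Re s \<Longrightarrow> F s = poly p s / poly q s" "p = 0 \<or> degree p + k \<le> degree q"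
    using F by (rule zero_at_inf_geE) blast
  obtain p' q' \<sigma>' where 2: "q' \<noteq> 0" "\<And>s. \<sigma>' < Re s \<Longrightarrow> G s = poly p' s / poly q' s" "p' = 0 \<or> degree p' + k \<le> degree q'"
    using G by (rule zero_at_inf_geE) blast
  have fin: "finite {s. poly (q * q') s = 0}" using 1(1) 2(1) by (intro poly_roots_finite) auto
  define \<tau> where "\<tau> = Max (insert 0 (Re ` {s. poly (q * q') s = 0}))"
  have nz: "poly q s \<noteq> 0" "poly q' s \<noteq> 0" if "\<tau> < Re s" for s
  proof -
    have "poly (q * q') s \<noteq> 0"
    proof
      assume "poly (q * q') s = 0"
      then have "Re s \<le> \<tau>" unfolding \<tau>_def using fin by (intro Max_ge) auto
      with that show False by simp
    qed
    then show "poly q s \<noteq> 0" "poly q' s \<noteq> 0" by auto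
  qed
  show ?thesis
  proof (rule zero_at_inf_geI[of "q * q'" "max \<tau> (max \<sigma> \<sigma>')" _ "p * q' + p' * q"])
    show "q * q' \<noteq> 0" using 1 2 by simp
    show "F s + G s = poly (p * q' + p' * q) s / poly (q * q') s" if "max \<tau> (max \<sigma> \<sigma>') < Re s" for s
      using that nz[of s] by (simp add: 1(2) 2(2) add_frac_eq)
    have d: "r = 0 \<or> degree (r * u) + k \<le> degree (v * u)" if "r = 0 \<or> degree r + k \<le> degree v" "u \<noteq> 0" "v \<noteq> 0"
      for r u v :: "complex poly" using that by (cases "r = 0") (auto simp: degree_mult_eq)
    have "p = 0 \<or> degree (p * q') + k \<le> degree (q * q')" "p' = 0 \<or> degree (p' * q) + k \<le> degree (q * q')"
      using d[OF 1(3) 2(1) 1(1)] d[OF 2(3) 1(1) 2(1)] by (auto simp: mult.commute)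
    then show "p * q' + p' * q = 0 \<or> degree (p * q' + p' * q) + k \<le> degree (q * q')"
      using degree_add_le_max[of "p * q'" "p' * q"] by (cases "p = 0"; cases "p' = 0") auto
  qed
qed

lemma zero_at_inf_ge_diff:
  assumes "zero_at_inf_ge F k" "zero_at_inf_ge G k"
  shows "zero_at_inf_ge (\<lambda>s. F s - G s) k"
  using zero_at_inf_ge_add[OF assms(1) zero_at_inf_ge_cmult[OF assms(2), of "-1"]] by simp

text \<open>Multiplication by \<open>s\<close> leaves a zero of order at least 1 at infinity.\<close>

lemma zero_at_inf_ge_tendsto:
  assumes "zero_at_inf_ge F 2"
  shows "((\<lambda>x::real. of_real x * F (of_real x)) \<longlongrightarrow> 0) at_top"
proof -
  obtain p q \<sigma> where pq: "q \<noteq> 0" "\<And>s. \<sigma> < Re s \<Longrightarrow> F s = poly p s / poly q s" "p = 0 \<or> degree p + 2 \<le> degree q"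
    using assms by (rule zero_at_inf_geE) blast
  have "((\<lambda>s. poly (pCons 0 p) s / poly q s) \<longlongrightarrow> 0) at_infinity"
  proof (cases "p = 0")
    case False
    then show ?thesis using pq(3) by (intro poly_divide_tendsto_0_at_infinity) simp
  qed simp
  moreover have "filterlim (\<lambda>x. of_real x :: complex) at_infinity at_top"
    by (rule filterlim_of_real_at_infinity)
  ultimately have "((\<lambda>x::real. poly (pCons 0 p) (of_real x) / poly q (of_real x)) \<longlongrightarrow> 0) at_top"
    by (rule filterlim_compose)
  then show ?thesis
  proof (rule Lim_transform_eventually)
    show "\<forall>\<^sub>F x::real in at_top. poly (pCons 0 p) (of_real x) / poly q (of_real x) = of_real x * F (of_real x)"
      using eventually_gt_at_top[of \<sigma>] by eventually_elim (simp add: pq(2))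
  qed
qed

section \<open>Signals with a rational transform\<close>

lemma set_integrable_laplace_ev:
  assumes "0 < Re s"
  shows "set_integrable lborel {0..} (\<lambda>t. exp (- s * of_real t) * of_real (ev e t))"
  using assms by (rule set_integrable_exp_bounded) (auto intro: abs_ev_le_norm)

lemma laplace_ev_add:
  assumes s: "0 < Re s"
  shows "laplace (ev (e + f)) s = laplace (ev e) s + laplace (ev f) s"
  unfolding laplace_def
    set_integral_add(2)[OF set_integrable_laplace_ev[OF s, of e] set_integrable_laplace_ev[OF s, of f], symmetric]
  by (simp add: distrib_left)

lemma laplace_ev_scale: "laplace (ev (c *\<^sub>R e)) s = of_real c * laplace (ev e) s"
  unfolding laplace_def by (simp add: mult.left_commute)

lemma laplace_ev_diff: "0 < Re s \<Longrightarrow> laplace (ev (e - f)) s = laplace (ev e) s - laplace (ev f) s"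
  using laplace_ev_add[of s "e - f" f] by simp

text \<open>For \<open>k = \<theta>\<^sub>p + \<theta>\<^sub>w\<close> this is the space of directions of the affine space \<open>X_theta\<close>.\<close>

definition rational_signals :: "nat \<Rightarrow> c0 set" where
  "rational_signals k = {h. zero_at_inf_ge (laplace (ev h)) k}"

lemma subspace_rational_signals: "subspace (rational_signals k)"
proof (rule subspaceI)
  show "0 \<in> rational_signals k"
    unfolding rational_signals_def mem_Collect_eq
    by (rule zero_at_inf_ge_cong[OF zero_at_inf_ge_zero]) (simp add: laplace_def)
  show "x + y \<in> rational_signals k" if "x \<in> rational_signals k" "y \<in> rational_signals k" for x y
    using that unfolding rational_signals_def mem_Collect_eq
    by (rule zero_at_inf_ge_cong[OF zero_at_inf_ge_add]) (rule laplace_ev_add)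
  show "c *\<^sub>R x \<in> rational_signals k" if "x \<in> rational_signals k" for c x
    using that unfolding rational_signals_def mem_Collect_eq
    by (rule zero_at_inf_ge_cong[OF zero_at_inf_ge_cmult]) (rule laplace_ev_scale)
qed

text \<open>The transform of \<open>w\<close> cancels in the difference of two members of \<open>X_theta\<close>. Conversely, adding
  a signal with a zero of order \<open>\<theta>\<^sub>p + \<theta>\<^sub>w\<close> preserves both conditions, as this order is at least \<open>\<theta>\<^sub>w\<close>.\<close>

lemma X_theta_iff_diff_rational:
  assumes e0: "e0 \<in> X_theta \<theta>\<^sub>p \<theta>\<^sub>w w"
  shows "e \<in> X_theta \<theta>\<^sub>p \<theta>\<^sub>w w \<longleftrightarrow> e - e0 \<in> rational_signals (\<theta>\<^sub>p + \<theta>\<^sub>w)"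
proof
  assume e: "e \<in> X_theta \<theta>\<^sub>p \<theta>\<^sub>w w"
  have "zero_at_inf_ge (\<lambda>s. (laplace (ev e) s - laplace w s) - (laplace (ev e0) s - laplace w s)) (\<theta>\<^sub>p + \<theta>\<^sub>w)"
    by (rule zero_at_inf_ge_diff) (use e e0 in \<open>auto simp: X_theta_def\<close>)
  then show "e - e0 \<in> rational_signals (\<theta>\<^sub>p + \<theta>\<^sub>w)"
    unfolding rational_signals_def mem_Collect_eq
    by (rule zero_at_inf_ge_cong[where \<tau> = 0]) (simp del: ev_simps add: laplace_ev_diff)
next
  assume h: "e - e0 \<in> rational_signals (\<theta>\<^sub>p + \<theta>\<^sub>w)"
  then have h: "zero_at_inf_ge (laplace (ev (e - e0))) (\<theta>\<^sub>p + \<theta>\<^sub>w)" by (simp add: rational_signals_def)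
  have "zero_at_inf_ge (\<lambda>s. laplace (ev (e - e0)) s + laplace (ev e0) s) \<theta>\<^sub>w"
    using e0 h by (intro zero_at_inf_ge_add zero_at_inf_ge_mono[OF h]) (auto simp: X_theta_def)
  then have "zero_at_inf_ge (laplace (ev e)) \<theta>\<^sub>w"
    by (rule zero_at_inf_ge_cong[where \<tau> = 0]) (simp del: ev_simps add: laplace_ev_diff)
  moreover have "zero_at_inf_ge (\<lambda>s. laplace (ev (e - e0)) s + (laplace (ev e0) s - laplace w s)) (\<theta>\<^sub>p + \<theta>\<^sub>w)"
    using e0 h by (intro zero_at_inf_ge_add) (auto simp: X_theta_def)
  then have "zero_at_inf_ge (\<lambda>s. laplace (ev e) s - laplace w s) (\<theta>\<^sub>p + \<theta>\<^sub>w)"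
    by (rule zero_at_inf_ge_cong[where \<tau> = 0]) (simp del: ev_simps add: laplace_ev_diff)
  ultimately show "e \<in> X_theta \<theta>\<^sub>p \<theta>\<^sub>w w" by (simp add: X_theta_def)
qed

text \<open>The Bernstein monomials \<open>x\<^sup>k (1 - x)\<^sup>n\<close> at \<open>x = exp (- t)\<close>. For \<open>k = 0\<close> they do not tend to 0 at
  infinity, and the signal is set to 0.\<close>

lift_definition bernstein_signal :: "nat \<Rightarrow> nat \<Rightarrow> c0" is
  "\<lambda>n k t. if 0 \<le> t \<and> 0 < k then exp (- real k * t) * (1 - exp (- t)) ^ n else 0"
proof (intro conjI allI impI)
  fix n k :: nat
  have "continuous_on {0..} (\<lambda>t. exp (- real k * t) * (1 - exp (- t)) ^ n)"
    by (intro continuous_intros)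
  then show "continuous_on {0..} (\<lambda>t. if 0 \<le> t \<and> 0 < k then exp (- real k * t) * (1 - exp (- t)) ^ n else 0)"
    by (cases "0 < k") (simp_all cong: continuous_on_cong_simp)
  show "((\<lambda>t. if 0 \<le> t \<and> 0 < k then exp (- real k * t) * (1 - exp (- t)) ^ n else 0) \<longlongrightarrow> 0) at_top"
  proof (cases "0 < k")
    case True
    have "((\<lambda>t. exp (- real k * t)) \<longlongrightarrow> 0) at_top"
      by (intro filterlim_compose[OF exp_at_bot] filterlim_tendsto_neg_mult_at_bot[OF tendsto_const] filterlim_ident)
         (use True in auto)
    moreover have "((\<lambda>t::real. exp (- t)) \<longlongrightarrow> 0) at_top"
      by (intro filterlim_compose[OF exp_at_bot] filterlim_uminus_at_bot_at_top)
    then have "((\<lambda>t::real. (1 - exp (- t)) ^ n) \<longlongrightarrow> (1 - 0) ^ n) at_top"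
      by (intro tendsto_intros)
    ultimately have "((\<lambda>t. exp (- real k * t) * (1 - exp (- t)) ^ n) \<longlongrightarrow> 0 * (1 - 0) ^ n) at_top"
      by (rule tendsto_mult)
    then have "((\<lambda>t. exp (- real k * t) * (1 - exp (- t)) ^ n) \<longlongrightarrow> 0) at_top" by simp
    then show ?thesis
    proof (rule Lim_transform_eventually)
      show "\<forall>\<^sub>F t in at_top. exp (- real k * t) * (1 - exp (- t)) ^ n
          = (if 0 \<le> t \<and> 0 < k then exp (- real k * t) * (1 - exp (- t)) ^ n else 0)"
        using eventually_ge_at_top[of 0] by eventually_elim (simp add: True)
    qed
  qed simp
qed auto

lemma bernstein_signal_rational:
  assumes "0 < k"
  shows "bernstein_signal n k \<in> rational_signals (Suc n)"
proof -
  define q where "q = (\<Prod>j\<le>n. [:of_nat (k + j), 1:] :: complex poly)"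
  have q: "q \<noteq> 0" "degree q = Suc n"
    unfolding q_def by (simp_all add: degree_prod_eq_sum_degree)
  have "laplace (ev (bernstein_signal n k)) s = poly [:fact n:] s / poly q s" if s: "0 < Re s" for s
  proof -
    have "laplace (ev (bernstein_signal n k)) s = laplace (\<lambda>t. exp (- real k * t) * (1 - exp (- t)) ^ n) s"
      unfolding laplace_def using assms
      by (intro set_lebesgue_integral_cong) (auto simp: bernstein_signal.rep_eq)
    also have "\<dots> = fact n / (\<Prod>j\<le>n. (s + of_real (real k)) + of_nat j)"
      unfolding laplace_exp_shift using s by (intro laplace_one_minus_exp_power) simp
    also have "(\<Prod>j\<le>n. (s + of_real (real k)) + of_nat j) = poly q s"
      by (simp add: q_def poly_prod add_ac)
    finally show ?thesis by simp
  qed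
  then show ?thesis
    unfolding rational_signals_def mem_Collect_eq
    using q by (intro zero_at_inf_geI[of q 0 _ "[:fact n:]"]) auto
qed

section \<open>Initial values\<close>

text \<open>The weight \<open>x exp (- x t)\<close> has integral 1 and concentrates at 0 as \<open>x \<rightarrow> \<infinity>\<close>. On \<open>t \<ge> \<delta>\<close> it is at most
  \<open>x exp (- (x - a) \<delta>) exp (- a t)\<close>, and the integral of \<open>\<bar>w - \<alpha>\<bar>\<close> with this weight tends to 0.\<close>

lemma initial_value_theorem:
  assumes conv: "laplace_converges w" and lim: "(w \<longlongrightarrow> \<alpha>) (at_right 0)"
  shows "((\<lambda>x::real. of_real x * laplace w (of_real x)) \<longlongrightarrow> of_real \<alpha>) at_top"
proof -
  obtain \<sigma> where \<sigma>: "\<And>s. \<sigma> < Re s \<Longrightarrow> set_integrable lborel {0..} (\<lambda>t. exp (- s * of_real t) * of_real (w t))"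
    using conv by (auto simp: laplace_converges_def)
  \<comment> \<open>The transforms of \<open>w\<close> and of the constants both converge at \<open>a\<close>.\<close>
  define a where "a = max \<sigma> 0 + 1"
  have a: "0 < a" "\<sigma> < a" by (auto simp: a_def)
  have int: "set_integrable lborel {0..} (\<lambda>t. exp (- x * t) * w t)"
    and lap: "laplace w (of_real x) = of_real (LINT t:{0..}|lborel. exp (- x * t) * w t)" if "a \<le> x" for x
  proof -
    have eq: "exp (- complex_of_real x * of_real t) * of_real (w t) = of_real (exp (- x * t) * w t)" for t
      by (simp add: exp_of_real[symmetric])
    show "set_integrable lborel {0..} (\<lambda>t. exp (- x * t) * w t)"
      using \<sigma>[of "of_real x"] that a unfolding eq by (auto simp: set_integrable_def simp del: of_real_mult dest!: integrable_bounded_linear[OF bounded_linear_Re])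
    show "laplace w (of_real x) = of_real (LINT t:{0..}|lborel. exp (- x * t) * w t)"
      unfolding laplace_def eq by (rule set_integral_complex_of_real)
  qed
  define v where "v t = w t - \<alpha>" for t
  have intv: "set_integrable lborel {0..} (\<lambda>t. exp (- x * t) * v t)"
    and lapv: "x * (LINT t:{0..}|lborel. exp (- x * t) * w t) - \<alpha> = x * (LINT t:{0..}|lborel. exp (- x * t) * v t)"
    if x: "a \<le> x" for x
  proof -
    have x0: "0 < x" using x a by simp
    have eq: "exp (- x * t) * v t = exp (- x * t) * w t - exp (- x * t) * \<alpha>" for t
      by (simp add: v_def right_diff_distrib)
    have i: "set_integrable lborel {0..} (\<lambda>t. exp (- x * t) * \<alpha>)"
      using set_integrable_exp_minus(1)[OF x0] by (intro set_integrable_mult_left) simp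
    show "set_integrable lborel {0..} (\<lambda>t. exp (- x * t) * v t)"
      unfolding eq by (rule set_integral_diff(1)[OF int[OF x] i])
    show "x * (LINT t:{0..}|lborel. exp (- x * t) * w t) - \<alpha> = x * (LINT t:{0..}|lborel. exp (- x * t) * v t)"
      unfolding eq set_integral_diff(2)[OF int[OF x] i]
      using set_integrable_exp_minus(2)[OF x0] x0 by (simp add: right_diff_distrib)
  qed
  define C where "C = (LINT t:{0..}|lborel. exp (- a * t) * \<bar>v t\<bar>)"
  have intC: "set_integrable lborel {0..} (\<lambda>t. exp (- a * t) * \<bar>v t\<bar>)"
    using set_integrable_abs[OF intv[of a]] by (simp add: abs_mult)
  have "((\<lambda>x. x * (LINT t:{0..}|lborel. exp (- x * t) * w t)) \<longlongrightarrow> \<alpha>) at_top"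
  proof (rule tendstoI)
    fix \<epsilon> :: real assume \<epsilon>: "0 < \<epsilon>"
    obtain \<delta> where \<delta>: "0 < \<delta>" "\<And>t. 0 < t \<Longrightarrow> t < \<delta> \<Longrightarrow> \<bar>v t\<bar> < \<epsilon> / 2"
      using tendstoD[OF lim half_gt_zero[OF \<epsilon>]] unfolding eventually_at_right_field v_def dist_real_def by auto
    have bound: "\<bar>x * (LINT t:{0..}|lborel. exp (- x * t) * w t) - \<alpha>\<bar> \<le> \<epsilon> / 2 + x * exp (- (x - a) * \<delta>) * C"
      if x: "a \<le> x" for x
    proof -
      have x0: "0 < x" using x a by simp
      have pw: "\<bar>exp (- x * t) * v t\<bar> \<le> exp (- x * t) * (\<epsilon> / 2) + exp (- (x - a) * \<delta>) * (exp (- a * t) * \<bar>v t\<bar>)"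
        if "0 < t" for t
      proof (cases "t < \<delta>")
        case True
        then have "exp (- x * t) * \<bar>v t\<bar> \<le> exp (- x * t) * (\<epsilon> / 2)"
          using \<delta>(2)[OF that] by (intro mult_left_mono) auto
        moreover have "0 \<le> exp (- (x - a) * \<delta>) * (exp (- a * t) * \<bar>v t\<bar>)" by simp
        ultimately show ?thesis unfolding abs_mult abs_exp_cancel by linarith
      next
        case False
        have "(x - a) * \<delta> \<le> (x - a) * t" using False x by (intro mult_left_mono) auto
        then have "exp (- x * t) \<le> exp (- (x - a) * \<delta>) * exp (- a * t)"
          by (simp add: exp_add[symmetric] algebra_simps)
        then have "exp (- x * t) * \<bar>v t\<bar> \<le> (exp (- (x - a) * \<delta>) * exp (- a * t)) * \<bar>v t\<bar>"
          by (intro mult_right_mono) auto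
        moreover have "0 \<le> exp (- x * t) * (\<epsilon> / 2)" using \<epsilon> by simp
        ultimately show ?thesis by (simp add: abs_mult mult.assoc)
      qed
      have i1: "set_integrable lborel {0..} (\<lambda>t. exp (- x * t) * (\<epsilon> / 2))"
        using set_integrable_exp_minus(1)[OF x0] by (intro set_integrable_mult_left) simp
      have i2: "set_integrable lborel {0..} (\<lambda>t. exp (- (x - a) * \<delta>) * (exp (- a * t) * \<bar>v t\<bar>))"
        using intC by (intro set_integrable_mult_right) simp
      have "\<bar>LINT t:{0..}|lborel. exp (- x * t) * v t\<bar> \<le> (LINT t:{0..}|lborel. \<bar>exp (- x * t) * v t\<bar>)"
        using set_integral_norm_bound[OF intv[OF x]] by simp
      also have "\<dots> \<le> (LINT t:{0..}|lborel. exp (- x * t) * (\<epsilon> / 2) + exp (- (x - a) * \<delta>) * (exp (- a * t) * \<bar>v t\<bar>))"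
        unfolding set_lebesgue_integral_def
      proof (rule integral_mono_AE)
        show "integrable lborel (\<lambda>t. indicator {0..} t *\<^sub>R \<bar>exp (- x * t) * v t\<bar>)"
          using set_integrable_abs[OF intv[OF x]] by (simp add: set_integrable_def)
        show "integrable lborel (\<lambda>t. indicator {0..} t *\<^sub>R (exp (- x * t) * (\<epsilon> / 2) + exp (- (x - a) * \<delta>) * (exp (- a * t) * \<bar>v t\<bar>)))"
          using set_integral_add(1)[OF i1 i2] by (simp add: set_integrable_def)
        show "AE t in lborel. indicator {0..} t *\<^sub>R \<bar>exp (- x * t) * v t\<bar>
            \<le> indicator {0..} t *\<^sub>R (exp (- x * t) * (\<epsilon> / 2) + exp (- (x - a) * \<delta>) * (exp (- a * t) * \<bar>v t\<bar>))"
          using AE_lborel_singleton[of "0::real"]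
        proof eventually_elim
          case (elim t)
          then show ?case using pw[of t] by (cases "0 \<le> t") auto
        qed
      qed
      also have "\<dots> = (\<epsilon> / 2) / x + exp (- (x - a) * \<delta>) * C"
        unfolding set_integral_add(2)[OF i1 i2] using set_integrable_exp_minus(2)[OF x0]
        by (simp add: C_def)
      finally have "x * \<bar>LINT t:{0..}|lborel. exp (- x * t) * v t\<bar> \<le> x * ((\<epsilon> / 2) / x + exp (- (x - a) * \<delta>) * C)"
        using x0 by (intro mult_left_mono) auto
      also have "\<dots> = \<epsilon> / 2 + x * exp (- (x - a) * \<delta>) * C" using x0 by (simp add: distrib_left)
      finally show ?thesis unfolding lapv[OF x] using x0 by (simp add: abs_mult)
    qed
    \<comment> \<open>The error term vanishes in the limit, by comparison of \<open>y\<close> with \<open>exp y\<close> at \<open>y = \<delta> x\<close>.\<close>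
    have "((\<lambda>y::real. y ^ 1 / exp y) \<longlongrightarrow> 0) at_top" by (rule tendsto_power_div_exp_0)
    moreover have "filterlim (\<lambda>x. \<delta> * x) at_top at_top"
      using \<delta>(1) by (intro filterlim_tendsto_pos_mult_at_top[OF tendsto_const] filterlim_ident)
    ultimately have "((\<lambda>x. (\<delta> * x) ^ 1 / exp (\<delta> * x)) \<longlongrightarrow> 0) at_top" by (rule filterlim_compose)
    then have "((\<lambda>x. exp (a * \<delta>) * C / \<delta> * ((\<delta> * x) ^ 1 / exp (\<delta> * x))) \<longlongrightarrow> exp (a * \<delta>) * C / \<delta> * 0) at_top"
      by (intro tendsto_mult tendsto_const)
    moreover have "exp (a * \<delta>) * C / \<delta> * ((\<delta> * x) ^ 1 / exp (\<delta> * x)) = x * exp (- (x - a) * \<delta>) * C" for x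
    proof -
      have "exp (- (x - a) * \<delta>) = exp (a * \<delta>) / exp (\<delta> * x)" by (simp add: exp_diff[symmetric] algebra_simps)
      then show ?thesis using \<delta>(1) by simp
    qed
    ultimately have "((\<lambda>x. x * exp (- (x - a) * \<delta>) * C) \<longlongrightarrow> 0) at_top" by simp
    then have "\<forall>\<^sub>F x in at_top. x * exp (- (x - a) * \<delta>) * C < \<epsilon> / 2"
      using \<epsilon> by (intro order_tendstoD(2)) auto
    then show "\<forall>\<^sub>F x in at_top. dist (x * (LINT t:{0..}|lborel. exp (- x * t) * w t)) \<alpha> < \<epsilon>"
      using eventually_ge_at_top[of a]
    proof eventually_elim
      case (elim x)
      then show ?case using bound[of x] by (simp add: dist_real_def)
    qed
  qed
  then have "((\<lambda>x. complex_of_real (x * (LINT t:{0..}|lborel. exp (- x * t) * w t))) \<longlongrightarrow> of_real \<alpha>) at_top"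
    by (rule tendsto_of_real)
  then show ?thesis
  proof (rule Lim_transform_eventually)
    show "\<forall>\<^sub>F x in at_top. complex_of_real (x * (LINT t:{0..}|lborel. exp (- x * t) * w t)) = of_real x * laplace w (of_real x)"
      using eventually_ge_at_top[of a] by eventually_elim (simp add: lap)
  qed
qed

text \<open>The transform of \<open>e - w\<close> has a zero of order at least 2 at infinity, so the initial values of \<open>e\<close>
  and \<open>w\<close> agree.\<close>

lemma X_theta_initial_value:
  assumes w: "laplace_converges w" "(w \<longlongrightarrow> \<alpha>) (at_right 0)" and N: "2 \<le> \<theta>\<^sub>p + \<theta>\<^sub>w"
    and e: "e \<in> X_theta \<theta>\<^sub>p \<theta>\<^sub>w w"
  shows "ev e 0 = \<alpha>"
proof -
  have "laplace_converges (ev e)"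
    unfolding laplace_converges_def using set_integrable_laplace_ev by blast
  moreover have "(ev e \<longlongrightarrow> ev e 0) (at_right 0)"
    using continuous_on_ev[of e] unfolding continuous_on_def by (auto intro: tendsto_within_subset)
  ultimately have "((\<lambda>x::real. of_real x * laplace (ev e) (of_real x)) \<longlongrightarrow> of_real (ev e 0)) at_top"
    by (rule initial_value_theorem)
  from tendsto_diff[OF this initial_value_theorem[OF w]]
  have "((\<lambda>x::real. of_real x * (laplace (ev e) (of_real x) - laplace w (of_real x))) \<longlongrightarrow> of_real (ev e 0 - \<alpha>)) at_top"
    by (simp add: right_diff_distrib)
  moreover have "((\<lambda>x::real. of_real x * (laplace (ev e) (of_real x) - laplace w (of_real x))) \<longlongrightarrow> 0) at_top"
    using e N by (intro zero_at_inf_ge_tendsto zero_at_inf_ge_mono[OF _ N]) (auto simp: X_theta_def)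
  ultimately have "complex_of_real (ev e 0 - \<alpha>) = 0"
    by (rule tendsto_unique[OF trivial_limit_at_top_linorder])
  then show ?thesis by simp
qed

section \<open>Density of the signals with a rational transform\<close>

lemma ev_sum: "ev (sum f A) t = (\<Sum>a\<in>A. ev (f a) t)"
  by (induction A rule: infinite_finite_induct) auto

text \<open>All Bernstein terms of degree \<open>m\<close> that occur have an exponent of \<open>x\<close> that is positive, because
  \<open>g 0 = 0\<close>, and an exponent of \<open>1 - x\<close> that is at least \<open>n\<close>, because \<open>g\<close> vanishes near 1 and \<open>m\<close> is
  large. After the substitution \<open>x = exp (- t)\<close> they are signals with a zero of order at least \<open>n + 1\<close>
  at infinity.\<close>

lemma rational_signal_near_Bernstein:
  fixes g :: "real \<Rightarrow> real"
  assumes g: "continuous_on {0..1} g" "g 0 = 0" and b: "n = 0 \<or> (\<exists>b<1. \<forall>x\<in>{b<..1}. g x = 0)" and \<epsilon>: "0 < \<epsilon>"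
  shows "\<exists>h\<in>rational_signals (Suc n). \<forall>t\<ge>0. \<bar>g (exp (- t)) - ev h t\<bar> < \<epsilon>"
proof -
  obtain N where N: "\<And>m x. N \<le> m \<Longrightarrow> x \<in> {0..1} \<Longrightarrow> \<bar>g x - (\<Sum>k\<le>m. g (real k / real m) * Bernstein m k x)\<bar> < \<epsilon>"
    using Bernstein_Weierstrass[OF g(1) \<epsilon>] by blast
  obtain m where m: "N \<le> m" "0 < m" and tail: "\<And>k. k \<le> m \<Longrightarrow> g (real k / real m) \<noteq> 0 \<Longrightarrow> n \<le> m - k"
  proof (cases "n = 0")
    case True
    then show thesis using that[of "Suc N"] by simp
  next
    case False
    then obtain b where b: "b < 1" "\<And>x. b < x \<Longrightarrow> x \<le> 1 \<Longrightarrow> g x = 0" using assms(3) by auto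
    \<comment> \<open>A term with \<open>k \<le> b m\<close> has \<open>m - k \<ge> (1 - b) m\<close>, which is to exceed \<open>n\<close>.\<close>
    obtain m :: nat where "real N + real n / (1 - b) + 1 < real m" using reals_Archimedean2 by blast
    moreover have "0 \<le> real n / (1 - b)" using b by simp
    ultimately have m: "N \<le> m" "0 < m" "real n / (1 - b) < real m" by linarith+
    have "n \<le> m - k" if k: "k \<le> m" "g (real k / real m) \<noteq> 0" for k
    proof -
      have "real k / real m \<le> b"
        using b(2)[of "real k / real m"] k m(2) by (cases "b < real k / real m") auto
      then have "real k \<le> b * real m" using m(2) by (simp add: pos_divide_le_eq)
      moreover have "real n < real m * (1 - b)" using m(3) b(1) by (simp add: pos_divide_less_eq)
      ultimately have "real n < real m - real k" by (simp add: algebra_simps)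
      then show ?thesis using k(1) by linarith
    qed
    then show thesis using that m by blast
  qed
  define h where "h = (\<Sum>k\<le>m. (g (real k / real m) * real (m choose k)) *\<^sub>R bernstein_signal (m - k) k)"
  have "h \<in> rational_signals (Suc n)"
    unfolding h_def
  proof (rule subspace_sum[OF subspace_rational_signals])
    fix k assume k: "k \<in> {..m}"
    show "(g (real k / real m) * real (m choose k)) *\<^sub>R bernstein_signal (m - k) k \<in> rational_signals (Suc n)"
    proof (cases "g (real k / real m) = 0")
      case True
      then show ?thesis using subspace_0[OF subspace_rational_signals] by simp
    next
      case False
      then have "0 < k" using g(2) by (cases k) auto
      moreover have "Suc n \<le> Suc (m - k)" using tail[of k] k False by simp
      ultimately have "bernstein_signal (m - k) k \<in> rational_signals (Suc n)"
        using bernstein_signal_rational[of k "m - k"] zero_at_inf_ge_mono unfolding rational_signals_def by blast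
      then show ?thesis by (rule subspace_scale[OF subspace_rational_signals])
    qed
  qed
  moreover have "\<bar>g (exp (- t)) - ev h t\<bar> < \<epsilon>" if t: "0 \<le> t" for t
  proof -
    have "ev h t = (\<Sum>k\<le>m. g (real k / real m) * Bernstein m k (exp (- t)))"
      unfolding h_def ev_sum
    proof (rule sum.cong[OF refl])
      fix k
      show "ev ((g (real k / real m) * real (m choose k)) *\<^sub>R bernstein_signal (m - k) k) t
          = g (real k / real m) * Bernstein m k (exp (- t))"
        using t g(2) by (cases "k = 0") (simp_all add: bernstein_signal.rep_eq Bernstein_def exp_of_nat_mult[symmetric])
    qed
    then show ?thesis using N[OF m(1), of "exp (- t)"] t by simp
  qed
  ultimately show ?thesis by blast
qed

text \<open>The substitution \<open>t = - ln x\<close> turns the half-line into \<open>{0<..1}\<close>; the function extends by 0 to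
  \<open>x = 0\<close> because it tends to 0 at infinity.\<close>

lemma rational_signal_near_function:
  assumes F: "continuous_on {0..} F" "(F \<longlongrightarrow> 0) at_top"
    and d: "n = 0 \<or> (\<exists>d>0. \<forall>t\<in>{0..<d}. F t = 0)" and \<epsilon>: "0 < (\<epsilon>::real)"
  shows "\<exists>h\<in>rational_signals (Suc n). \<forall>t\<ge>0. \<bar>F t - ev h t\<bar> < \<epsilon>"
proof -
  define g where "g x = (if x = 0 then 0 else F (- ln x))" for x
  have "continuous_on {0..1} g"
    unfolding continuous_on_def
  proof
    fix x :: real assume x: "x \<in> {0..1}"
    show "(g \<longlongrightarrow> g x) (at x within {0..1})"
    proof (cases "x = 0")
      case True
      have "((\<lambda>x. F (- ln x)) \<longlongrightarrow> 0) (at_right 0)"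
        by (intro filterlim_compose[OF F(2)] filterlim_compose[OF filterlim_uminus_at_top_at_bot] ln_at_0)
      moreover have "\<forall>\<^sub>F x in at_right 0. F (- ln x) = g x"
        using eventually_at_right_less[of 0] by eventually_elim (simp add: g_def)
      ultimately have "(g \<longlongrightarrow> 0) (at_right 0)" by (rule Lim_transform_eventually)
      moreover have "at (0::real) within {0..1} = at_right 0"
        by (rule at_within_Icc_at_right) simp
      ultimately show ?thesis using True by (simp add: g_def)
    next
      case False
      have "continuous_on {0<..1} (\<lambda>x. F (- ln x))"
        by (rule continuous_on_compose2[OF F(1)]) (auto intro!: continuous_intros)
      then have "((\<lambda>x. F (- ln x)) \<longlongrightarrow> F (- ln x)) (at x within {0<..1})"
        using x False by (auto simp: continuous_on_def)
      then have "(g \<longlongrightarrow> g x) (at x within {0<..1})"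
        using False by (auto simp: g_def eventually_at_filter intro: Lim_transform_eventually)
      moreover have "at x within {0..1} = at x within {0<..1}"
        by (rule at_within_nhd[where S = "{0<..}"]) (use x False in auto)
      ultimately show ?thesis by simp
    qed
  qed
  moreover have "n = 0 \<or> (\<exists>b<1. \<forall>x\<in>{b<..1}. g x = 0)"
  proof (cases "n = 0")
    case False
    then obtain d where d: "0 < d" "\<And>t. 0 \<le> t \<Longrightarrow> t < d \<Longrightarrow> F t = 0" using d by auto
    have "g x = 0" if "exp (- d) < x" "x \<le> 1" for x
    proof -
      have "0 < x" using that(1) exp_gt_zero[of "- d"] by linarith
      then have "ln (exp (- d)) < ln x" "ln x \<le> 0"
        using that by (auto simp only: ln_less_cancel_iff exp_gt_zero ln_le_zero_iff)
      then have "- ln x < d" "0 \<le> - ln x" by simp_all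
      then show ?thesis using d(2) by (simp add: g_def)
    qed
    then show ?thesis using d(1) by (intro disjI2 exI[of _ "exp (- d)"]) auto
  qed simp
  ultimately obtain h where "h \<in> rational_signals (Suc n)" "\<And>t. 0 \<le> t \<Longrightarrow> \<bar>g (exp (- t)) - ev h t\<bar> < \<epsilon>"
    using rational_signal_near_Bernstein[of g n \<epsilon>] \<epsilon> by (auto simp: g_def)
  then show ?thesis by (auto simp: g_def)
qed

text \<open>For \<open>n > 0\<close> a signal that vanishes at 0 is first moved towards 0 by at most \<open>\<delta>\<close> at each point
  (soft thresholding). The result is continuous and vanishes on a whole neighbourhood of 0.\<close>

lemma rational_signals_dense:
  assumes "n = 0 \<or> ev \<phi> 0 = 0"
  shows "\<phi> \<in> closure (rational_signals (Suc n))"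
  unfolding closure_approachable
proof (intro allI impI)
  fix \<epsilon> :: real assume \<epsilon>: "0 < \<epsilon>"
  define \<delta> where "\<delta> = \<epsilon> / 3"
  have \<delta>: "0 < \<delta>" using \<epsilon> by (simp add: \<delta>_def)
  define F where "F t = ev \<phi> t - max (- \<delta>) (min \<delta> (ev \<phi> t))" for t
  have close: "\<bar>ev \<phi> t - F t\<bar> \<le> \<delta>" for t using \<delta> by (auto simp: F_def)
  obtain h where h: "h \<in> rational_signals (Suc n)" "\<And>t. 0 \<le> t \<Longrightarrow> \<bar>ev \<phi> t - ev h t\<bar> \<le> 2 * \<delta>"
  proof (cases "n = 0")
    case True
    then have "\<exists>h\<in>rational_signals (Suc n). \<forall>t\<ge>0. \<bar>ev \<phi> t - ev h t\<bar> < \<delta>"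
      by (intro rational_signal_near_function continuous_on_ev tendsto_ev \<delta>) simp
    then obtain h where "h \<in> rational_signals (Suc n)" "\<And>t. 0 \<le> t \<Longrightarrow> \<bar>ev \<phi> t - ev h t\<bar> < \<delta>" by blast
    moreover from this(2) have "\<bar>ev \<phi> t - ev h t\<bar> \<le> 2 * \<delta>" if "0 \<le> t" for t
      using that \<delta> by (smt (verit))
    ultimately show thesis using that by blast
  next
    case False
    have "continuous_on {0..} F" unfolding F_def by (intro continuous_intros continuous_on_ev)
    moreover have "(F \<longlongrightarrow> 0 - max (- \<delta>) (min \<delta> 0)) at_top"
      unfolding F_def by (intro tendsto_intros tendsto_ev)
    then have "(F \<longlongrightarrow> 0) at_top" using \<delta> by simp
    moreover have "\<exists>d>0. \<forall>t\<in>{0..<d}. F t = 0"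
    proof -
      obtain d where d: "0 < d" "\<And>t. 0 \<le> t \<Longrightarrow> dist t 0 < d \<Longrightarrow> dist (ev \<phi> t) (ev \<phi> 0) < \<delta>"
        using continuous_on_ev[of \<phi>, unfolded continuous_on_iff, rule_format, of 0 \<delta>] \<delta> by auto
      have "F t = 0" if "0 \<le> t" "t < d" for t
        using d(2)[of t] that assms False by (auto simp: F_def dist_real_def)
      then show ?thesis using d(1) by auto
    qed
    ultimately obtain h where h: "h \<in> rational_signals (Suc n)" "\<And>t. 0 \<le> t \<Longrightarrow> \<bar>F t - ev h t\<bar> < \<delta>"
      using rational_signal_near_function[of F n \<delta>] \<delta> by blast
    have "\<bar>ev \<phi> t - ev h t\<bar> \<le> 2 * \<delta>" if "0 \<le> t" for t using close[of t] h(2)[OF that] by linarith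
    with h(1) that show thesis by blast
  qed
  have "norm (h - \<phi>) \<le> 2 * \<delta>"
    using h(2) by (intro norm_c0_leI) (simp add: abs_minus_commute)
  then have "dist h \<phi> < \<epsilon>" using \<epsilon> by (simp add: dist_norm \<delta>_def)
  with h(1) show "\<exists>h\<in>rational_signals (Suc n). dist h \<phi> < \<epsilon>" by blast
qed

section \<open>Exponential modes\<close>

text \<open>Dividing the relation by \<open>exp (\<mu> t)\<close> and differentiating removes the exponent \<open>\<mu>\<close> and multiplies
  the other coefficients by the nonzero numbers \<open>\<omega> - \<mu>\<close>.\<close>

lemma exponentials_independent:
  fixes c :: "complex \<Rightarrow> complex"
  assumes "finite S" "\<And>t::real. (\<Sum>\<omega>\<in>S. c \<omega> * exp (\<omega> * of_real t)) = 0"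
  shows "\<forall>\<omega>\<in>S. c \<omega> = 0"
  using assms
proof (induction S arbitrary: c rule: finite_induct)
  case empty
  then show ?case by simp
next
  case (insert \<mu> S)
  define G where "G t = c \<mu> + (\<Sum>\<omega>\<in>S. c \<omega> * exp ((\<omega> - \<mu>) * of_real t))" for t :: real
  have G0: "G t = 0" for t
  proof -
    have "G t = exp (- \<mu> * of_real t) * (\<Sum>\<omega>\<in>insert \<mu> S. c \<omega> * exp (\<omega> * of_real t))"
      using insert.hyps
      by (simp add: G_def distrib_left sum_distrib_left mult.left_commute exp_add[symmetric])
         (simp add: algebra_simps)
    also have "\<dots> = 0" by (simp add: insert.prems)
    finally show ?thesis .
  qed
  have "(\<Sum>\<omega>\<in>S. (c \<omega> * (\<omega> - \<mu>)) * exp (\<omega> * of_real t)) = 0" for t :: real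
  proof -
    have "(G has_vector_derivative (\<Sum>\<omega>\<in>S. c \<omega> * (exp ((\<omega> - \<mu>) * of_real t) * (\<omega> - \<mu>)))) (at t)"
      unfolding G_def
      by (rule derivative_eq_intros has_vector_derivative_real_field refl | simp)+
    moreover have "(G has_vector_derivative 0) (at t)"
    proof -
      have "G = (\<lambda>_. 0)" using G0 by auto
      then show ?thesis by simp
    qed
    ultimately have "(\<Sum>\<omega>\<in>S. c \<omega> * (exp ((\<omega> - \<mu>) * of_real t) * (\<omega> - \<mu>))) = 0"
      by (rule vector_derivative_unique_at)
    then have "exp (\<mu> * of_real t) * (\<Sum>\<omega>\<in>S. c \<omega> * (exp ((\<omega> - \<mu>) * of_real t) * (\<omega> - \<mu>))) = 0" by simp
    moreover have "exp (\<mu> * of_real t) * (c \<omega> * (exp ((\<omega> - \<mu>) * of_real t) * (\<omega> - \<mu>)))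
        = (c \<omega> * (\<omega> - \<mu>)) * exp (\<omega> * of_real t)" for \<omega>
    proof -
      have "exp (\<omega> * of_real t) = exp (\<mu> * of_real t) * exp ((\<omega> - \<mu>) * of_real t)"
        by (simp add: exp_add[symmetric] algebra_simps)
      then show ?thesis by simp
    qed
    ultimately show ?thesis by (simp add: sum_distrib_left)
  qed
  from insert.IH[OF this] have S: "c \<omega> = 0" if "\<omega> \<in> S" for \<omega>
    using that insert.hyps(2) by auto
  moreover have "c \<mu> = 0" using G0[of 0] S by (simp add: G_def)
  ultimately show ?case by auto
qed

text \<open>The exponents carry a minus sign because the modes of a root \<open>z\<close> are the real and imaginary
  parts of \<open>exp (- z t)\<close> up to sign.\<close>

definition exp_span :: "complex set \<Rightarrow> (real \<Rightarrow> complex) set" where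
  "exp_span S = {F. \<exists>c. \<forall>t. F t = (\<Sum>\<omega>\<in>S. c \<omega> * exp (- \<omega> * of_real t))}"

lemma exp_span_add: "F \<in> exp_span S \<Longrightarrow> G \<in> exp_span S \<Longrightarrow> (\<lambda>t. F t + G t) \<in> exp_span S"
  unfolding exp_span_def by (auto simp: sum.distrib[symmetric] distrib_right[symmetric])

lemma exp_span_cmult: "F \<in> exp_span S \<Longrightarrow> (\<lambda>t. a * F t) \<in> exp_span S"
  unfolding exp_span_def by (auto simp: sum_distrib_left mult.assoc[symmetric])

lemma exp_span_zero: "(\<lambda>_. 0) \<in> exp_span S"
  unfolding exp_span_def by (auto intro!: exI[of _ "\<lambda>_. 0"])

lemma exp_span_sum: "(\<And>i. i \<in> I \<Longrightarrow> F i \<in> exp_span S) \<Longrightarrow> (\<lambda>t. \<Sum>i\<in>I. F i t) \<in> exp_span S"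
  by (induction I rule: infinite_finite_induct) (auto simp: exp_span_zero intro: exp_span_add)

lemma exp_span_exp: "finite S \<Longrightarrow> \<omega> \<in> S \<Longrightarrow> (\<lambda>t. exp (- \<omega> * of_real t)) \<in> exp_span S"
  unfolding exp_span_def
  by (auto intro!: exI[of _ "\<lambda>\<mu>. if \<mu> = \<omega> then 1 else 0"] simp: if_distrib if_distribR sum.delta cong: if_cong)

lemma exp_span_mono:
  assumes "A \<subseteq> B" "finite B" "F \<in> exp_span A"
  shows "F \<in> exp_span B"
proof -
  obtain c where "F = (\<lambda>t. \<Sum>\<omega>\<in>A. c \<omega> * exp (- \<omega> * of_real t))"
    using assms(3) by (auto simp: exp_span_def)
  then show ?thesis
    using assms(1,2) by (simp only:) (intro exp_span_sum exp_span_cmult exp_span_exp, auto)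
qed

lemma exp_span_disjoint:
  assumes "finite A" "finite B" "A \<inter> B = {}" "F \<in> exp_span A" "F \<in> exp_span B"
  shows "F t = 0"
proof -
  obtain c where c: "\<And>t. F t = (\<Sum>\<omega>\<in>A. c \<omega> * exp (- \<omega> * of_real t))"
    using assms(4) by (auto simp: exp_span_def)
  obtain d where d: "\<And>t. F t = (\<Sum>\<omega>\<in>B. d \<omega> * exp (- \<omega> * of_real t))"
    using assms(5) by (auto simp: exp_span_def)
  \<comment> \<open>The coefficients of the difference of the two representations, indexed by the exponents \<open>- \<omega>\<close>.\<close>
  define e where "e \<mu> = (if - \<mu> \<in> A then c (- \<mu>) else - d (- \<mu>))" for \<mu>
  have "(\<Sum>\<mu>\<in>uminus ` (A \<union> B). e \<mu> * exp (\<mu> * of_real t)) = 0" for t :: real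
  proof -
    have "(\<Sum>\<mu>\<in>uminus ` (A \<union> B). e \<mu> * exp (\<mu> * of_real t)) = (\<Sum>\<omega>\<in>A \<union> B. e (- \<omega>) * exp (- \<omega> * of_real t))"
      by (subst sum.reindex) (auto simp: inj_on_def)
    also have "\<dots> = (\<Sum>\<omega>\<in>A. e (- \<omega>) * exp (- \<omega> * of_real t)) + (\<Sum>\<omega>\<in>B. e (- \<omega>) * exp (- \<omega> * of_real t))"
      using assms by (intro sum.union_disjoint) auto
    also have "(\<Sum>\<omega>\<in>A. e (- \<omega>) * exp (- \<omega> * of_real t)) = F t"
      unfolding c by (intro sum.cong) (auto simp: e_def)
    also have "(\<Sum>\<omega>\<in>B. e (- \<omega>) * exp (- \<omega> * of_real t)) = - F t"
      unfolding d sum_negf[symmetric] using assms(3) by (intro sum.cong) (auto simp: e_def)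
    finally show ?thesis by simp
  qed
  then have "\<forall>\<mu>\<in>uminus ` (A \<union> B). e \<mu> = 0"
    using assms(1,2) by (intro exponentials_independent) auto
  then have "c \<omega> = 0" if "\<omega> \<in> A" for \<omega> using that by (force simp: e_def)
  then show ?thesis by (simp add: c)
qed

lemma mode_listE:
  assumes "m \<in> set (mode_list zs)"
  obtains z where "z \<in> set zs" "m = (\<lambda>t. exp (- Re z * t) * cos (Im z * t)) \<or> m = (\<lambda>t. exp (- Re z * t) * sin (Im z * t))"
  using assms that by (auto simp: mode_list_def modes_def split: if_splits)

lemma mode_in_exp_span:
  assumes m: "m \<in> set (mode_list zs)"
  shows "(\<lambda>t. complex_of_real (m t)) \<in> exp_span (set zs \<union> cnj ` set zs)"
proof -
  let ?S = "set zs \<union> cnj ` set zs"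
  obtain z where z: "z \<in> set zs" and "m = (\<lambda>t. exp (- Re z * t) * cos (Im z * t)) \<or> m = (\<lambda>t. exp (- Re z * t) * sin (Im z * t))"
    using m by (rule mode_listE)
  have e: "(\<lambda>t. exp (- z * of_real t)) \<in> exp_span ?S" "(\<lambda>t. exp (- cnj z * of_real t)) \<in> exp_span ?S"
    by (rule exp_span_exp; use z in auto)+
  have eq: "exp (- z * of_real t) = Complex (exp (- Re z * t) * cos (Im z * t)) (- (exp (- Re z * t) * sin (Im z * t)))"
      "exp (- cnj z * of_real t) = Complex (exp (- Re z * t) * cos (Im z * t)) (exp (- Re z * t) * sin (Im z * t))" for t
    by (simp_all add: complex_eq_iff Re_exp Im_exp)
  have cos: "(\<lambda>t. complex_of_real (exp (- Re z * t) * cos (Im z * t)))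
      = (\<lambda>t. 1 / 2 * exp (- z * of_real t) + 1 / 2 * exp (- cnj z * of_real t))"
    and sin: "(\<lambda>t. complex_of_real (exp (- Re z * t) * sin (Im z * t)))
      = (\<lambda>t. \<i> / 2 * exp (- z * of_real t) + (- \<i> / 2) * exp (- cnj z * of_real t))"
    unfolding eq by (auto simp: fun_eq_iff complex_eq_iff)
  from \<open>m = _ \<or> m = _\<close> show ?thesis
  proof
    assume m: "m = (\<lambda>t. exp (- Re z * t) * cos (Im z * t))"
    show ?thesis unfolding m cos by (intro exp_span_add exp_span_cmult e)
  next
    assume m: "m = (\<lambda>t. exp (- Re z * t) * sin (Im z * t))"
    show ?thesis unfolding m sin by (intro exp_span_add exp_span_cmult e)
  qed
qed

lemma fun_span_mode_list_exp_span:
  assumes "f \<in> fun_span (mode_list zs)"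
  shows "(\<lambda>t. complex_of_real (f t)) \<in> exp_span (set zs \<union> cnj ` set zs)"
proof -
  obtain c where f: "f = (\<lambda>t. \<Sum>i<length (mode_list zs). c i * (mode_list zs ! i) t)"
    using assms by (auto simp: fun_span_def)
  have "(\<lambda>t. complex_of_real (f t)) = (\<lambda>t. \<Sum>i<length (mode_list zs). complex_of_real (c i) * complex_of_real ((mode_list zs ! i) t))"
    by (simp add: f)
  also have "\<dots> \<in> exp_span (set zs \<union> cnj ` set zs)"
    by (intro exp_span_sum exp_span_cmult mode_in_exp_span) auto
  finally show ?thesis .
qed

text \<open>Two decompositions of the same function differ by a function in the span of the exponentials of
  the \<open>zs\<close> that is also in the span of the exponentials of the \<open>ps\<close> and \<open>vs\<close>. The two sets of exponents
  are disjoint, so this function is 0.\<close>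

lemma proj1_mode_spans:
  fixes zs ps vs :: "complex list"
  assumes disj: "(set zs \<union> cnj ` set zs) \<inter> (set ps \<union> cnj ` set ps \<union> set vs \<union> cnj ` set vs) = {}"
    and uvx: "u \<in> fun_span (mode_list zs)" "v \<in> fun_span (mode_list ps)" "x \<in> fun_span (mode_list vs)"
  shows "proj1 (fun_span (mode_list zs)) (fun_span (mode_list ps)) (fun_span (mode_list vs)) (\<lambda>t. u t + v t + x t) = u"
  unfolding proj1_def
proof (rule the_equality)
  show "u \<in> fun_span (mode_list zs) \<and> (\<exists>v'\<in>fun_span (mode_list ps). \<exists>x'\<in>fun_span (mode_list vs).
      (\<lambda>t. u t + v t + x t) = (\<lambda>t. u t + v' t + x' t))" using uvx by blast
next
  fix u' assume "u' \<in> fun_span (mode_list zs) \<and> (\<exists>v'\<in>fun_span (mode_list ps). \<exists>x'\<in>fun_span (mode_list vs).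
      (\<lambda>t. u t + v t + x t) = (\<lambda>t. u' t + v' t + x' t))"
  then obtain v' x' where u': "u' \<in> fun_span (mode_list zs)" "v' \<in> fun_span (mode_list ps)" "x' \<in> fun_span (mode_list vs)"
    and eq: "(\<lambda>t. u t + v t + x t) = (\<lambda>t. u' t + v' t + x' t)" by blast
  let ?A = "set zs \<union> cnj ` set zs" and ?B = "set ps \<union> cnj ` set ps \<union> set vs \<union> cnj ` set vs"
  let ?F = "\<lambda>t. complex_of_real (u' t) + (-1) * complex_of_real (u t)"
  have A: "?F \<in> exp_span ?A"
    by (intro exp_span_add exp_span_cmult fun_span_mode_list_exp_span u' uvx)
  have B: "(\<lambda>t. complex_of_real (f t)) \<in> exp_span ?B"
    if "f \<in> fun_span (mode_list ps) \<or> f \<in> fun_span (mode_list vs)" for f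
    using that fun_span_mode_list_exp_span[of f ps] fun_span_mode_list_exp_span[of f vs]
    by (auto intro: exp_span_mono[of "set ps \<union> cnj ` set ps"] exp_span_mono[of "set vs \<union> cnj ` set vs"])
  have "?F = (\<lambda>t. (complex_of_real (v t) + complex_of_real (x t))
      + (-1) * (complex_of_real (v' t) + complex_of_real (x' t)))"
  proof
    fix t
    have "complex_of_real (u t + v t + x t) = complex_of_real (u' t + v' t + x' t)" using fun_cong[OF eq] by simp
    then show "?F t = (complex_of_real (v t) + complex_of_real (x t)) + (-1) * (complex_of_real (v' t) + complex_of_real (x' t))"
      by (simp add: algebra_simps)
  qed
  also have "\<dots> \<in> exp_span ?B"
    by (intro exp_span_add exp_span_cmult B) (use u' uvx in auto)
  finally have "?F t = 0" for t by (intro exp_span_disjoint[OF _ _ disj A]) auto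
  then show "u' = u" by (auto simp: fun_eq_iff)
qed

lemma mode_integrable:
  assumes m: "m \<in> set (mode_list zs)" and zs: "\<And>z. z \<in> set zs \<Longrightarrow> 0 < Re z"
  shows "set_integrable lborel {0..} m"
proof -
  obtain z where z: "z \<in> set zs" and "m = (\<lambda>t. exp (- Re z * t) * cos (Im z * t)) \<or> m = (\<lambda>t. exp (- Re z * t) * sin (Im z * t))"
    using m by (rule mode_listE)
  then have bound: "\<bar>m t\<bar> \<le> exp (- Re z * t)" and [measurable]: "m \<in> borel_measurable borel" for t
    by (auto simp: abs_mult mult_left_le)
  show ?thesis
    unfolding set_integrable_def
  proof (rule Bochner_Integration.integrable_bound)
    show "integrable lborel (\<lambda>t. indicator {0..} t *\<^sub>R exp (- Re z * t))"
      using set_integrable_exp_minus(1)[OF zs[OF z]] by (simp add: set_integrable_def)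
    show "AE t in lborel. norm (indicator {0..} t *\<^sub>R m t) \<le> norm (indicator {0..} t *\<^sub>R exp (- Re z * t))"
      using bound by (auto simp: indicator_def)
  qed measurable
qed

lemma set_integrable_ev_mult:
  assumes g: "set_integrable lborel {0..} g"
  shows "set_integrable lborel {0..} (\<lambda>t. ev e t * g t)"
  unfolding set_integrable_def
proof (rule Bochner_Integration.integrable_bound)
  show "integrable lborel (\<lambda>t. norm e * (indicator {0..} t *\<^sub>R g t))"
    using g by (simp add: set_integrable_def)
  have [measurable]: "(\<lambda>t. indicator {0..} t *\<^sub>R g t) \<in> borel_measurable borel"
    using g by (auto simp: set_integrable_def dest!: borel_measurable_integrable)
  have "(\<lambda>t. ev e t * (indicator {0..} t *\<^sub>R g t)) \<in> borel_measurable lborel" by measurable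
  then show "(\<lambda>t. indicator {0..} t *\<^sub>R (ev e t * g t)) \<in> borel_measurable lborel"
    by (simp add: mult.left_commute)
  show "AE t in lborel. norm (indicator {0..} t *\<^sub>R (ev e t * g t)) \<le> norm (norm e * (indicator {0..} t *\<^sub>R g t))"
  proof (rule AE_I2)
    fix t
    show "norm (indicator {0..} t *\<^sub>R (ev e t * g t)) \<le> norm (norm e * (indicator {0..} t *\<^sub>R g t))"
      using mult_right_mono[OF abs_ev_le_norm[of e t], of "\<bar>g t\<bar>"] by (auto simp: indicator_def abs_mult)
  qed
qed

lemma bounded_linear_ip:
  assumes g: "set_integrable lborel {0..} g"
  shows "bounded_linear (\<lambda>e. ip (ev e) g)"
proof (rule bounded_linear_intro)
  note i = set_integrable_ev_mult[OF g]
  show "ip (ev (e + f)) g = ip (ev e) g + ip (ev f) g" for e f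
    unfolding ip_def set_integral_add(2)[OF i i, symmetric] by (simp add: distrib_right)
  show "ip (ev (c *\<^sub>R e)) g = c *\<^sub>R ip (ev e) g" for c e
    unfolding ip_def by (simp add: mult.assoc)
  show "norm (ip (ev e) g) \<le> norm e * (LINT t:{0..}|lborel. \<bar>g t\<bar>)" for e
  proof -
    have "norm (ip (ev e) g) \<le> (LINT t:{0..}|lborel. norm (ev e t * g t))"
      unfolding ip_def by (rule set_integral_norm_bound[OF i])
    also have "\<dots> \<le> (LINT t:{0..}|lborel. norm e * \<bar>g t\<bar>)"
    proof (rule set_integral_mono)
      show "set_integrable lborel {0..} (\<lambda>t. norm (ev e t * g t))" using set_integrable_norm[OF i] .
      show "set_integrable lborel {0..} (\<lambda>t. norm e * \<bar>g t\<bar>)"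
        using set_integrable_abs[OF g] by (intro set_integrable_mult_right) simp
      show "norm (ev e t * g t) \<le> norm e * \<bar>g t\<bar>" for t
        using mult_right_mono[OF abs_ev_le_norm[of e t], of "\<bar>g t\<bar>"] by (simp add: abs_mult)
    qed
    finally show ?thesis by simp
  qed
qed

lemma bounded_linear_ev: "bounded_linear (\<lambda>e. ev e t)"
  by (rule bounded_linear_intro[where K = 1]) (auto simp: abs_ev_le_norm)

lemma fun_span_integrable:
  assumes "\<And>a. a \<in> set gs \<Longrightarrow> set_integrable lborel {0..} (\<lambda>t. u t * a t)"
    and "f = (\<lambda>t. \<Sum>i<length gs. c i * (gs ! i) t)"
  shows "set_integrable lborel {0..} (\<lambda>t. u t * f t)"
    and "ip u f = (\<Sum>i<length gs. c i * ip u (gs ! i))"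
proof -
  have eq: "(\<lambda>t. u t * f t) = (\<lambda>t. \<Sum>i<length gs. c i * (u t * (gs ! i) t))"
    by (simp add: assms(2) sum_distrib_left mult.left_commute)
  have i: "integrable lborel (\<lambda>t. c i * (indicator {0..} t *\<^sub>R (u t * (gs ! i) t)))" if "i < length gs" for i
    using assms(1)[of "gs ! i"] that by (simp add: set_integrable_def)
  have eq2: "(\<lambda>t. indicator {0..} t *\<^sub>R (u t * f t)) = (\<lambda>t. \<Sum>i<length gs. c i * (indicator {0..} t *\<^sub>R (u t * (gs ! i) t)))"
    by (subst fun_cong[OF eq]) (simp add: sum_distrib_left mult.left_commute fun_eq_iff)
  show "set_integrable lborel {0..} (\<lambda>t. u t * f t)"
    unfolding set_integrable_def eq2 by (intro Bochner_Integration.integrable_sum i) simp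
  have "ip u f = (\<Sum>i<length gs. (\<integral>t. c i * (indicator {0..} t *\<^sub>R (u t * (gs ! i) t)) \<partial>lborel))"
    unfolding ip_def set_lebesgue_integral_def eq2 by (intro Bochner_Integration.integral_sum i) simp
  then show "ip u f = (\<Sum>i<length gs. c i * ip u (gs ! i))"
    by (simp add: ip_def set_lebesgue_integral_def)
qed

lemma fun_span_Cons: "f \<in> fun_span (g # gs) \<longleftrightarrow> (\<exists>a. \<exists>h\<in>fun_span gs. f = (\<lambda>t. a * g t + h t))"
proof
  assume "f \<in> fun_span (g # gs)"
  then obtain c where "f = (\<lambda>t. \<Sum>i<Suc (length gs). c i * ((g # gs) ! i) t)" by (auto simp: fun_span_def)
  then have "f = (\<lambda>t. c 0 * g t + (\<Sum>i<length gs. c (Suc i) * (gs ! i) t))"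
    by (simp add: sum.lessThan_Suc_shift del: sum.lessThan_Suc)
  then show "\<exists>a. \<exists>h\<in>fun_span gs. f = (\<lambda>t. a * g t + h t)"
    by (intro exI[of _ "c 0"] bexI[of _ "\<lambda>t. \<Sum>i<length gs. c (Suc i) * (gs ! i) t"])
       (auto simp: fun_span_def intro!: exI[of _ "\<lambda>i. c (Suc i)"])
next
  assume "\<exists>a. \<exists>h\<in>fun_span gs. f = (\<lambda>t. a * g t + h t)"
  then obtain a c where "f = (\<lambda>t. a * g t + (\<Sum>i<length gs. c i * (gs ! i) t))" by (auto simp: fun_span_def)
  then have "f = (\<lambda>t. \<Sum>i<length (g # gs). (case_nat a c) i * ((g # gs) ! i) t)"
    by (simp add: sum.lessThan_Suc_shift del: sum.lessThan_Suc)
  then show "f \<in> fun_span (g # gs)" unfolding fun_span_def by blast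
qed

lemma fun_span_append:
  assumes "f \<in> fun_span (as @ bs)"
  obtains u v where "u \<in> fun_span as" "v \<in> fun_span bs" "f = (\<lambda>t. u t + v t)"
  using assms
proof (induction as arbitrary: f thesis)
  case Nil
  moreover have "(\<lambda>_. 0) \<in> fun_span []" by (simp add: fun_span_def)
  ultimately show ?case by force
next
  case (Cons a as)
  then obtain c h where "h \<in> fun_span (as @ bs)" and f: "f = (\<lambda>t. c * a t + h t)"
    by (auto simp: fun_span_Cons)
  then obtain u v where uv: "u \<in> fun_span as" "v \<in> fun_span bs" "h = (\<lambda>t. u t + v t)" using Cons.IH by blast
  then have "(\<lambda>t. c * a t + u t) \<in> fun_span (a # as)" by (auto simp: fun_span_Cons)
  with uv f show ?case using Cons.prems(1)[of "\<lambda>t. c * a t + u t" v] by (simp add: add.assoc)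
qed

lemma fun_span_zero: "(\<lambda>_. 0) \<in> fun_span gs"
  by (auto simp: fun_span_def intro!: exI[of _ "\<lambda>_. 0"])

section \<open>Duality\<close>

lemma conjugate_ge:
  "e \<in> T \<Longrightarrow> ereal (pairing \<mu> e - f e) \<le> conjugate (\<lambda>e. ereal (f e) + ind T e) \<mu>"
  unfolding conjugate_def by (rule SUP_upper2[of e]) (auto simp: ind_def)

lemma conjugate_le:
  "(\<And>e. e \<in> T \<Longrightarrow> pairing \<mu> e - f e \<le> c) \<Longrightarrow> conjugate (\<lambda>e. ereal (f e) + ind T e) \<mu> \<le> ereal c"
  unfolding conjugate_def by (rule SUP_least) (auto simp: ind_def)

text \<open>If the infimum is finite, it is itself a lower bound, and weak duality turns the inequality for
  the multiplier given by \<open>strong\<close> into an equality. If it is \<open>- \<infinity>\<close>, weak duality forces \<open>\<Phi>\<close> to be \<open>- \<infinity>\<close>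
  everywhere, and every multiplier attains the maximum.\<close>

lemma is_max_dualI:
  fixes f :: "'a \<Rightarrow> real" and \<Phi> :: "'b \<Rightarrow> ereal"
  assumes ne: "F \<noteq> {}" "\<Gamma> \<noteq> {}"
    and weak: "\<And>\<mu> e. \<mu> \<in> \<Gamma> \<Longrightarrow> e \<in> F \<Longrightarrow> \<Phi> \<mu> \<le> ereal (f e)"
    and strong: "\<And>v. (\<And>e. e \<in> F \<Longrightarrow> v \<le> f e) \<Longrightarrow> \<exists>\<mu>\<in>\<Gamma>. ereal v \<le> \<Phi> \<mu>"
  shows "is_max (INF e\<in>F. ereal (f e)) (\<Phi> ` \<Gamma>)"
proof -
  let ?I = "INF e\<in>F. ereal (f e)"
  have le: "\<Phi> \<mu> \<le> ?I" if "\<mu> \<in> \<Gamma>" for \<mu> using weak[OF that] by (rule INF_greatest)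
  obtain e where e: "e \<in> F" using ne by blast
  then have "?I \<le> ereal (f e)" by (rule INF_lower)
  then consider "?I = - \<infinity>" | v where "?I = ereal v" by (cases ?I) auto
  then obtain \<mu> where "\<mu> \<in> \<Gamma>" "?I \<le> \<Phi> \<mu>"
  proof cases
    case 1
    then show thesis using ne(2) that by auto
  next
    case 2
    have "v \<le> f e" if "e \<in> F" for e
      using INF_lower[OF that, of "\<lambda>e. ereal (f e)"] 2 by simp
    from strong[OF this] show thesis using 2 that by auto
  qed
  with le have "?I = \<Phi> \<mu>" by (simp add: antisym)
  with \<open>\<mu> \<in> \<Gamma>\<close> le show ?thesis by (auto simp: is_max_def)
qed

lemma is_max_imp_Sup_eq: "is_max m S \<Longrightarrow> Sup S = m"
  unfolding is_max_def by (intro antisym Sup_least Sup_upper) auto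

text \<open>The signal \<open>bernstein_signal 0 1\<close>, that is \<open>exp (- t)\<close>, takes the value 1 at 0 and spans a complement
  of the signals that vanish there.\<close>

lemma functional_eq_multiple_of_value_at_0:
  assumes d: "linear d" "\<And>h. ev h 0 = 0 \<Longrightarrow> d h = 0"
  shows "d h = d (bernstein_signal 0 1) * ev h 0"
proof -
  have "ev (h - ev h 0 *\<^sub>R bernstein_signal 0 1) 0 = 0" by (simp add: bernstein_signal.rep_eq)
  then have "d (h - ev h 0 *\<^sub>R bernstein_signal 0 1) = 0" by (rule d(2))
  then show ?thesis using d(1) by (simp add: linear_diff linear_cmul)
qed

text \<open>The supporting functional \<open>l\<close> for the linear constraints is a combination of the pairings with
  the modes on the signals with a rational transform. Its difference from this combination is
  continuous and vanishes on them, hence on their closure: everywhere if \<open>n = 0\<close>, and otherwise at least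
  where the value at 0 is 0, so that the difference is a multiple of the evaluation at 0.\<close>

lemma supporting_mode_functional:
  assumes T: "convex T" "e0 \<in> interior T" and f: "convex_on UNIV f" "continuous_on UNIV f"
    and L: "\<And>a. a \<in> set L \<Longrightarrow> set_integrable lborel {0..} a"
    and v: "\<And>e. e \<in> T \<Longrightarrow> e - e0 \<in> rational_signals (Suc n) \<Longrightarrow> (\<And>a. a \<in> set L \<Longrightarrow> ip (ev e) a = ip (ev e0) a) \<Longrightarrow> v \<le> f e"
  obtains g l where "g \<in> fun_span L" "n = 0 \<Longrightarrow> l = 0"
    "\<And>e. e \<in> T \<Longrightarrow> v + (ip (ev e) g + l * ev e 0) - (ip (ev e0) g + l * ev e0 0) \<le> f e"
proof -
  have lin: "linear (\<lambda>h. ip (ev h) a)" if "a \<in> set L" for a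
    using bounded_linear_ip[OF L[OF that]] by (rule bounded_linear.linear)
  define K where "K = {h \<in> rational_signals (Suc n). \<forall>a\<in>set L. ip (ev h) a = 0}"
  have K: "subspace K"
  proof (rule subspaceI)
    show "0 \<in> K"
      unfolding K_def using linear_0[OF lin] subspace_0[OF subspace_rational_signals] by blast
    show "x + y \<in> K" if "x \<in> K" "y \<in> K" for x y
      using that unfolding K_def
      by (auto intro: subspace_add[OF subspace_rational_signals] simp: linear_add[OF lin] simp del: ev_simps)
    show "c *\<^sub>R x \<in> K" if "x \<in> K" for c x
      using that unfolding K_def
      by (auto intro: subspace_scale[OF subspace_rational_signals] simp: linear_cmul[OF lin] simp del: ev_simps)
  qed
  have "v \<le> f (e0 + h)" if "h \<in> K" "e0 + h \<in> T" for h
    using that by (intro v) (auto simp: K_def linear_add[OF lin] simp del: ev_simps)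
  moreover have "convex_on T f" using f(1) T(1) by (auto intro: convex_on_subset)
  moreover have "isCont f e0" using f(2) by (simp add: continuous_on_eq_continuous_at)
  ultimately obtain l where l: "bounded_linear l" "\<And>h. h \<in> K \<Longrightarrow> l h = 0"
      "\<And>e. e \<in> T \<Longrightarrow> v + l (e - e0) \<le> f e"
    using affine_minorant_on_subspace_constraint[OF T _ _ K, of f v] by blast
  have "\<exists>c. \<forall>x\<in>rational_signals (Suc n). l x = (\<Sum>i<length L. c i * ip (ev x) (L ! i))"
    using l(2) by (intro functional_vanishing_on_common_kernel bounded_linear.linear[OF l(1)] subspace_rational_signals lin)
      (auto simp: K_def)
  then obtain c where c: "\<And>x. x \<in> rational_signals (Suc n) \<Longrightarrow> l x = (\<Sum>i<length L. c i * ip (ev x) (L ! i))" by blast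
  define g where "g = (\<lambda>t. \<Sum>i<length L. c i * (L ! i) t)"
  have g: "set_integrable lborel {0..} g"
    using fun_span_integrable(1)[of L "\<lambda>_. 1" g c] L by (simp add: g_def)
  have ip_g: "ip (ev x) g = (\<Sum>i<length L. c i * ip (ev x) (L ! i))" for x
    by (rule fun_span_integrable(2)[OF _ g_def]) (rule set_integrable_ev_mult[OF L])
  define d where "d h = l h - ip (ev h) g" for h
  have d: "bounded_linear d" unfolding d_def by (intro bounded_linear_sub l(1) bounded_linear_ip g)
  have "closed {h. d h = 0}"
    by (intro closed_Collect_eq continuous_on_const) (use d in \<open>simp add: linear_continuous_on\<close>)
  then have "closure (rational_signals (Suc n)) \<subseteq> {h. d h = 0}"
    by (intro closure_minimal) (auto simp: d_def c ip_g)
  then have d0: "d h = 0" if "n = 0 \<or> ev h 0 = 0" for h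
    using rational_signals_dense[OF that] by auto
  define r where "r = d (bernstein_signal 0 1)"
  have d_eq: "d h = r * ev h 0" for h
    unfolding r_def using d0 by (intro functional_eq_multiple_of_value_at_0 bounded_linear.linear[OF d]) auto
  have l_eq: "l h = ip (ev h) g + r * ev h 0" for h using d_eq[of h] by (simp add: d_def)
  show thesis
  proof (rule that[of g r])
    show "g \<in> fun_span L" by (auto simp: fun_span_def g_def)
    show "r = 0" if "n = 0" using d0 that by (simp add: r_def)
    show "v + (ip (ev e) g + r * ev e 0) - (ip (ev e0) g + r * ev e0 0) \<le> f e" if "e \<in> T" for e
    proof -
      have "l (e - e0) = l e - l e0" using l(1) by (simp add: linear_diff bounded_linear.linear)
      then show ?thesis using l(3)[OF that] by (simp add: l_eq)
    qed
  qed
qed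

text \<open>The objective of \<open>f\<^sup>#\<close> is the dual of the minimisation of \<open>f e - \<langle>g, e\<rangle>\<close> over the \<open>e \<in> T\<close> with the
  same value at 0 as \<open>e0\<close>. A functional that vanishes on the signals with value 0 at 0 is a multiple
  of the evaluation at 0, so a supporting functional is a real number.\<close>

lemma sharp_attained:
  assumes T: "convex T" "e0 \<in> interior T" and f: "convex_on UNIV f" "continuous_on UNIV f"
    and g: "set_integrable lborel {0..} g"
  shows "is_max (sharp (ev e0 0) (\<lambda>e. ereal (f e) + ind T e) (dens g))
      (range (sharp_obj (ev e0 0) (\<lambda>e. ereal (f e) + ind T e) (dens g)))"
proof -
  let ?\<alpha> = "ev e0 0" and ?f = "\<lambda>e. f e - ip (ev e) g"
  have "is_max (INF e\<in>{e \<in> T. ev e 0 = ?\<alpha>}. ereal (?f e))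
      (range (sharp_obj ?\<alpha> (\<lambda>e. ereal (f e) + ind T e) (dens g)))"
  proof (rule is_max_dualI)
    show "{e \<in> T. ev e 0 = ?\<alpha>} \<noteq> {}" using T(2) interior_subset by blast
    show "sharp_obj ?\<alpha> (\<lambda>e. ereal (f e) + ind T e) (dens g) l \<le> ereal (?f e)"
      if "e \<in> {e \<in> T. ev e 0 = ?\<alpha>}" for l e
    proof -
      have "ereal (ip (ev e) g + l * ?\<alpha> - f e) \<le> conjugate (\<lambda>e. ereal (f e) + ind T e) (dens g + l *\<^sub>R delta0)"
        using conjugate_ge[of e T "dens g + l *\<^sub>R delta0" f] that by (simp add: pairing_dens_delta0[OF g])
      then show ?thesis
        unfolding sharp_obj_def
        by (cases "conjugate (\<lambda>e. ereal (f e) + ind T e) (dens g + l *\<^sub>R delta0)") (auto simp: algebra_simps)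
    qed
  next
    fix v assume v: "\<And>e. e \<in> {e \<in> T. ev e 0 = ?\<alpha>} \<Longrightarrow> v \<le> ?f e"
    have lin: "linear (\<lambda>e. ip (ev e) g)" using bounded_linear_ip[OF g] by (rule bounded_linear.linear)
    have "convex_on UNIV ?f"
      using f(1) unfolding convex_on_def
      by (auto simp: linear_add[OF lin] linear_cmul[OF lin] algebra_simps simp del: ev_simps)
    then have conv: "convex_on T ?f" using T(1) by (auto intro: convex_on_subset)
    have "continuous_on UNIV ?f"
      by (intro continuous_on_diff f(2) linear_continuous_on bounded_linear_ip g)
    then have cont: "isCont ?f e0" by (simp add: continuous_on_eq_continuous_at)
    have K: "subspace {h. ev h 0 = 0}" by (auto simp: subspace_def)
    obtain l where l: "bounded_linear l" "\<And>h. h \<in> {h. ev h 0 = 0} \<Longrightarrow> l h = 0"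
        "\<And>e. e \<in> T \<Longrightarrow> v + l (e - e0) \<le> ?f e"
    proof (rule affine_minorant_on_subspace_constraint[OF T conv cont K, of v])
      show "v \<le> ?f (e0 + h)" if "h \<in> {h. ev h 0 = 0}" "e0 + h \<in> T" for h
        using that by (intro v) simp
    qed (use that in blast)
    define r where "r = l (bernstein_signal 0 1)"
    have l_eq: "l h = r * ev h 0" for h
      unfolding r_def using l(2) by (intro functional_eq_multiple_of_value_at_0 bounded_linear.linear[OF l(1)]) auto
    have "conjugate (\<lambda>e. ereal (f e) + ind T e) (dens g + r *\<^sub>R delta0) \<le> ereal (r * ?\<alpha> - v)"
    proof (rule conjugate_le)
      fix e assume "e \<in> T"
      from l(3)[OF this] show "pairing (dens g + r *\<^sub>R delta0) e - f e \<le> r * ?\<alpha> - v"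
        by (simp add: pairing_dens_delta0[OF g] l_eq algebra_simps)
    qed
    then have "ereal v \<le> sharp_obj ?\<alpha> (\<lambda>e. ereal (f e) + ind T e) (dens g) r"
      unfolding sharp_obj_def
      by (cases "conjugate (\<lambda>e. ereal (f e) + ind T e) (dens g + r *\<^sub>R delta0)") (auto simp: algebra_simps)
    then show "\<exists>r\<in>UNIV. ereal v \<le> sharp_obj ?\<alpha> (\<lambda>e. ereal (f e) + ind T e) (dens g) r" by blast
  qed simp
  moreover from is_max_imp_Sup_eq[OF this]
  have "sharp ?\<alpha> (\<lambda>e. ereal (f e) + ind T e) (dens g) = (INF e\<in>{e \<in> T. ev e 0 = ?\<alpha>}. ereal (?f e))"
    by (simp add: sharp_def)
  ultimately show ?thesis by simp
qed

lemma mem_closure_X_theta: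
  assumes e0: "e0 \<in> X_theta \<theta>\<^sub>p \<theta>\<^sub>w w" and N: "\<theta>\<^sub>p + \<theta>\<^sub>w = Suc n" and \<phi>: "n = 0 \<or> ev \<phi> 0 = ev e0 0"
  shows "\<phi> \<in> closure (X_theta \<theta>\<^sub>p \<theta>\<^sub>w w)"
proof -
  have eq: "X_theta \<theta>\<^sub>p \<theta>\<^sub>w w = (+) e0 ` rational_signals (Suc n)"
  proof
    show "X_theta \<theta>\<^sub>p \<theta>\<^sub>w w \<subseteq> (+) e0 ` rational_signals (Suc n)"
    proof
      fix e assume "e \<in> X_theta \<theta>\<^sub>p \<theta>\<^sub>w w"
      then have "e - e0 \<in> rational_signals (Suc n)" using X_theta_iff_diff_rational[OF e0] N by simp
      then show "e \<in> (+) e0 ` rational_signals (Suc n)" by (intro image_eqI[of _ _ "e - e0"]) auto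
    qed
    show "(+) e0 ` rational_signals (Suc n) \<subseteq> X_theta \<theta>\<^sub>p \<theta>\<^sub>w w"
    proof
      fix e assume "e \<in> (+) e0 ` rational_signals (Suc n)"
      then have "e - e0 \<in> rational_signals (\<theta>\<^sub>p + \<theta>\<^sub>w)" using N by auto
      then show "e \<in> X_theta \<theta>\<^sub>p \<theta>\<^sub>w w" using X_theta_iff_diff_rational[OF e0] by blast
    qed
  qed
  have "\<phi> - e0 \<in> closure (rational_signals (Suc n))" using \<phi> by (intro rational_signals_dense) auto
  then have "e0 + (\<phi> - e0) \<in> (+) e0 ` closure (rational_signals (Suc n))" by blast
  then show ?thesis unfolding eq closure_translation by simp
qed

text \<open>A polynomial with real coefficients has a root set \<open>Z\<close> that is closed under conjugation. A common
  element of the two sets or its conjugate would therefore lie in \<open>Z \<inter> S\<close>.\<close>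

lemma conjugate_roots_disjoint:
  assumes NP: "Z = rhp_roots (map_poly of_real NP)" and S: "Z \<inter> S = {}" and sub: "set zs \<subseteq> Z" "set ss \<subseteq> S"
  shows "(set zs \<union> cnj ` set zs) \<inter> (set ss \<union> cnj ` set ss) = {}"
proof -
  have Z: "cnj s \<in> Z" if "s \<in> Z" for s
  proof -
    have "poly (map_poly of_real NP) (cnj s) = cnj (poly (map_poly of_real NP) s)"
      by (subst poly_cnj_real) (auto simp: coeff_map_poly)
    with that show ?thesis by (simp add: NP rhp_roots_def)
  qed
  have "s \<in> Z" if "s \<in> set zs \<union> cnj ` set zs" for s using that sub(1) Z by auto
  moreover have "s \<in> S \<or> cnj s \<in> S" if "s \<in> set ss \<union> cnj ` set ss" for s using that sub(2) by auto
  ultimately show ?thesis using S Z by blast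
qed

theorem proposition3p3:
  fixes NP DP :: "real poly"
    and nw dw :: "complex poly"
    and w :: "real \<Rightarrow> real"
    and \<theta>\<^sub>p \<theta>\<^sub>w :: nat
    and Z Pl V0 :: "complex set"
    and zs ps vs :: "complex list"
    and X :: "c0 set"
    and A :: "c0 \<Rightarrow> real list \<times> real list \<times> real list"
    and b :: "real list \<times> real list \<times> real list"
    and U V W :: "(real \<Rightarrow> real) set"
    and T :: "c0 set"
    and f0 :: "c0 \<Rightarrow> real"
  assumes plant: "NP \<noteq> 0" "DP \<noteq> 0" "coprime NP DP" "degree DP = degree NP + \<theta>\<^sub>p"
    and ref: "laplace_converges w" "is_rational (laplace w) nw dw" "coprime nw dw" "nw \<noteq> 0"
      "degree dw = degree nw + \<theta>\<^sub>w" "1 \<le> \<theta>\<^sub>w"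
    and roots: "Z = rhp_roots (map_poly of_real NP)" "Pl = rhp_roots (map_poly of_real DP)"
      "V0 = rhp_roots nw"
    and off_axis: "\<forall>s\<in>Z \<union> Pl \<union> V0. Re s \<noteq> 0"
    and simple: "\<forall>s\<in>Z. order s (map_poly of_real NP) = 1"
      "\<forall>s\<in>Pl. order s (map_poly of_real DP) = 1" "\<forall>s\<in>V0. order s nw = 1"
    and distinct: "Z \<inter> Pl = {}" "Z \<inter> V0 = {}" "Pl \<inter> V0 = {}"
    and retained: "conj_reps Z zs" "conj_reps Pl ps" "conj_reps V0 vs"
    and pairings_exist: "\<forall>a\<in>set (mode_list zs). set_integrable lborel {0..} (\<lambda>t. w t * a t)"
    and X: "X = X_theta \<theta>\<^sub>p \<theta>\<^sub>w w"
    and A: "A = opA zs ps vs"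
    and b: "b = vecb zs ps vs w"
    and UVW: "U = fun_span (mode_list zs)" "V = fun_span (mode_list ps)" "W = fun_span (mode_list vs)"
    and T: "convex T"
    and f0: "convex_on UNIV f0" "continuous_on UNIV f0"
    and slater: "b \<in> A ` (X \<inter> interior T)"
  shows
    "(\<theta>\<^sub>w + \<theta>\<^sub>p = 1 \<longrightarrow>
        closure X = UNIV \<and>
        is_max (INF e\<in>T \<inter> X \<inter> {e. A e = b}. ereal (f0 e))
          ((\<lambda>\<mu>. ereal (ip (proj1 U V W \<mu>) w)
                  - conjugate (\<lambda>e. ereal (f0 e) + ind T e) (dens \<mu>)) ` sum3 U V W))
   \<and> (\<forall>\<alpha>. \<theta>\<^sub>w + \<theta>\<^sub>p > 1 \<and> (w \<longlongrightarrow> \<alpha>) (at_right 0) \<longrightarrow>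
        closure X = {\<phi>. ev \<phi> 0 = \<alpha>} \<and>
        (\<forall>\<mu>\<in>sum3 U V W.
          is_max (sharp \<alpha> (\<lambda>e. ereal (f0 e) + ind T e) (dens \<mu>))
            (range (sharp_obj \<alpha> (\<lambda>e. ereal (f0 e) + ind T e) (dens \<mu>)))) \<and>
        is_max (INF e\<in>T \<inter> X \<inter> {e. A e = b}. ereal (f0 e))
          ((\<lambda>\<mu>. ereal (ip (proj1 U V W \<mu>) w)
                  + sharp \<alpha> (\<lambda>e. ereal (f0 e) + ind T e) (dens \<mu>)) ` sum3 U V W))"
proof -
  let ?fT = "\<lambda>e. ereal (f0 e) + ind T e"
  obtain e0 where e0: "e0 \<in> X" "e0 \<in> interior T" "A e0 = b" using slater by auto
  define F where "F = T \<inter> X \<inter> {e. A e = b}"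
  define L where "L = mode_list zs @ mode_list ps @ mode_list vs"
  have F_iff: "e \<in> F \<longleftrightarrow> e \<in> T \<and> e \<in> X \<and> (\<forall>a\<in>set (mode_list zs). ip (ev e) a = ip w a)
      \<and> (\<forall>a\<in>set (mode_list ps). ip (ev e) a = 0) \<and> (\<forall>a\<in>set (mode_list vs). ip (ev e) a = 0)" for e
    by (simp add: F_def A opA_def b vecb_def)
  have e0F: "e0 \<in> F" using e0 interior_subset by (auto simp: F_def)
  have sub: "set zs \<subseteq> Z" "set ps \<subseteq> Pl" "set vs \<subseteq> V0" using retained by (auto simp: conj_reps_def)
  have pos: "0 < Re s" if "s \<in> set zs \<union> set ps \<union> set vs" for s
  proof -
    have "s \<in> Z \<union> Pl \<union> V0" using that sub by auto
    then have "Re s \<noteq> 0" "0 \<le> Re s" using off_axis roots by (auto simp: rhp_roots_def)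
    then show ?thesis by simp
  qed
  have int: "set_integrable lborel {0..} a" if "a \<in> set L" for a
    using that pos mode_integrable[of a zs] mode_integrable[of a ps] mode_integrable[of a vs]
    by (auto simp: L_def)
  have disj: "(set zs \<union> cnj ` set zs) \<inter> (set ps \<union> cnj ` set ps \<union> set vs \<union> cnj ` set vs) = {}"
    using conjugate_roots_disjoint[OF roots(1) distinct(1) sub(1) sub(2)]
      conjugate_roots_disjoint[OF roots(1) distinct(2) sub(1) sub(3)] by blast

  \<comment> \<open>On feasible signals a multiplier pairs like its component in \<open>U\<close> with \<open>w\<close>.\<close>
  have span: "set_integrable lborel {0..} g \<and> (\<forall>e\<in>F. ip (ev e) g = ip (proj1 U V W g) w)"
    if "g \<in> sum3 U V W" for g
  proof -
    obtain u v x where uvx: "u \<in> U" "v \<in> V" "x \<in> W" and g: "g = (\<lambda>t. u t + v t + x t)"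
      using \<open>g \<in> sum3 U V W\<close> by (auto simp: sum3_def)
    have proj: "proj1 U V W g = u"
      using proj1_mode_spans[OF disj] uvx unfolding UVW g by blast
    obtain cu where u: "u = (\<lambda>t. \<Sum>i<length (mode_list zs). cu i * (mode_list zs ! i) t)"
      using uvx(1) by (auto simp: UVW fun_span_def)
    obtain cv where v: "v = (\<lambda>t. \<Sum>i<length (mode_list ps). cv i * (mode_list ps ! i) t)"
      using uvx(2) by (auto simp: UVW fun_span_def)
    obtain cx where x: "x = (\<lambda>t. \<Sum>i<length (mode_list vs). cx i * (mode_list vs ! i) t)"
      using uvx(3) by (auto simp: UVW fun_span_def)
    have I: "set_integrable lborel {0..} u" "set_integrable lborel {0..} v" "set_integrable lborel {0..} x"
      using fun_span_integrable(1)[of "mode_list zs" "\<lambda>_. 1", OF _ u] fun_span_integrable(1)[of "mode_list ps" "\<lambda>_. 1", OF _ v]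
        fun_span_integrable(1)[of "mode_list vs" "\<lambda>_. 1", OF _ x] int
      by (simp_all add: L_def)
    have "set_integrable lborel {0..} g"
      unfolding g by (intro set_integral_add I)
    moreover have "ip (ev e) g = ip (proj1 U V W g) w" if e: "e \<in> F" for e
    proof -
      note i = set_integrable_ev_mult[of _ e]
      have "ip (ev e) u = (\<Sum>i<length (mode_list zs). cu i * ip (ev e) (mode_list zs ! i))"
        using int by (intro fun_span_integrable(2)[OF i u]) (simp add: L_def)
      also have "\<dots> = (\<Sum>i<length (mode_list zs). cu i * ip w (mode_list zs ! i))"
        using e by (intro sum.cong) (auto simp: F_iff)
      also have "\<dots> = ip w u"
        using pairings_exist by (intro fun_span_integrable(2)[OF _ u, symmetric]) simp
      finally have U: "ip (ev e) u = ip u w" by (simp add: ip_def mult.commute)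
      have "ip (ev e) v = (\<Sum>i<length (mode_list ps). cv i * ip (ev e) (mode_list ps ! i))"
        using int by (intro fun_span_integrable(2)[OF i v]) (simp add: L_def)
      then have V: "ip (ev e) v = 0" using e by (simp add: F_iff)
      have "ip (ev e) x = (\<Sum>i<length (mode_list vs). cx i * ip (ev e) (mode_list vs ! i))"
        using int by (intro fun_span_integrable(2)[OF i x]) (simp add: L_def)
      then have W: "ip (ev e) x = 0" using e by (simp add: F_iff)
      have "ip (ev e) g = ip (ev e) u + ip (ev e) v + ip (ev e) x"
        unfolding ip_def g distrib_left
        by (simp add: set_integral_add i I)
      with U V W show ?thesis by (simp add: proj)
    qed
    ultimately show ?thesis by blast
  qed

  \<comment> \<open>A lower bound \<open>v\<close> on the feasible set yields a multiplier; for \<open>N = 1\<close> it has no mass at 0.\<close>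
  have dual: "\<exists>g l. g \<in> sum3 U V W \<and> (n = 0 \<longrightarrow> l = 0) \<and>
      conjugate ?fT (dens g + l *\<^sub>R delta0) \<le> ereal (ip (proj1 U V W g) w + l * ev e0 0 - v)"
    if n: "\<theta>\<^sub>p + \<theta>\<^sub>w = Suc n" and v: "\<And>e. e \<in> F \<Longrightarrow> v \<le> f0 e" for n v
  proof -
    have "v \<le> f0 e" if e: "e \<in> T" "e - e0 \<in> rational_signals (Suc n)" "\<And>a. a \<in> set L \<Longrightarrow> ip (ev e) a = ip (ev e0) a" for e
    proof (rule v)
      have "e \<in> X" using X_theta_iff_diff_rational[of e0 \<theta>\<^sub>p \<theta>\<^sub>w w e] e0(1) e(2) n by (simp add: X)
      then show "e \<in> F" using e0F e by (auto simp: F_iff L_def)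
    qed
    then obtain g l where g: "g \<in> fun_span L" and l: "n = 0 \<Longrightarrow> l = 0"
      and le: "\<And>e. e \<in> T \<Longrightarrow> v + (ip (ev e) g + l * ev e 0) - (ip (ev e0) g + l * ev e0 0) \<le> f0 e"
      using supporting_mode_functional[OF T e0(2) f0, of L n v] int by blast
    obtain u r where u: "u \<in> U" "r \<in> fun_span (mode_list ps @ mode_list vs)" "g = (\<lambda>t. u t + r t)"
      using g unfolding L_def UVW by (rule fun_span_append)
    obtain v' x where r: "v' \<in> V" "x \<in> W" "r = (\<lambda>t. v' t + x t)"
      using u(2) unfolding UVW by (rule fun_span_append)
    have gS: "g \<in> sum3 U V W" using u r by (auto simp: sum3_def add.assoc)
    have "conjugate ?fT (dens g + l *\<^sub>R delta0) \<le> ereal (ip (proj1 U V W g) w + l * ev e0 0 - v)"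
    proof (rule conjugate_le)
      fix e assume "e \<in> T"
      have "set_integrable lborel {0..} g" "ip (ev e0) g = ip (proj1 U V W g) w" using span[OF gS] e0F by auto
      with le[OF \<open>e \<in> T\<close>]
      show "pairing (dens g + l *\<^sub>R delta0) e - f0 e \<le> ip (proj1 U V W g) w + l * ev e0 0 - v"
        by (simp add: pairing_dens_delta0)
    qed
    with gS l show ?thesis by blast
  qed

  have ne: "sum3 U V W \<noteq> {}"
    using fun_span_zero unfolding sum3_def UVW by blast

  have case1: "closure X = UNIV \<and> is_max (INF e\<in>F. ereal (f0 e))
      ((\<lambda>\<mu>. ereal (ip (proj1 U V W \<mu>) w) - conjugate ?fT (dens \<mu>)) ` sum3 U V W)"
    if N: "\<theta>\<^sub>w + \<theta>\<^sub>p = 1"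
  proof
    have n: "\<theta>\<^sub>p + \<theta>\<^sub>w = Suc 0" using N by simp
    show "closure X = UNIV" using mem_closure_X_theta[OF e0(1)[unfolded X] n] by (auto simp: X)
    show "is_max (INF e\<in>F. ereal (f0 e))
      ((\<lambda>\<mu>. ereal (ip (proj1 U V W \<mu>) w) - conjugate ?fT (dens \<mu>)) ` sum3 U V W)"
    proof (rule is_max_dualI)
      fix g e assume g: "g \<in> sum3 U V W" and e: "e \<in> F"
      have "ereal (ip (proj1 U V W g) w - f0 e) \<le> conjugate ?fT (dens g)"
        using conjugate_ge[of e T "dens g" f0] span[OF g] e by (simp add: F_iff pairing_dens)
      then show "ereal (ip (proj1 U V W g) w) - conjugate ?fT (dens g) \<le> ereal (f0 e)"
        by (cases "conjugate ?fT (dens g)") auto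
    next
      fix v assume "\<And>e. e \<in> F \<Longrightarrow> v \<le> f0 e"
      from dual[OF n this] obtain g where g: "g \<in> sum3 U V W"
          "conjugate ?fT (dens g) \<le> ereal (ip (proj1 U V W g) w - v)" by force
      then have "ereal v \<le> ereal (ip (proj1 U V W g) w) - conjugate ?fT (dens g)"
        by (cases "conjugate ?fT (dens g)") auto
      with g(1) show "\<exists>\<mu>\<in>sum3 U V W. ereal v \<le> ereal (ip (proj1 U V W \<mu>) w) - conjugate ?fT (dens \<mu>)" by blast
    qed (use e0F ne in auto)
  qed

  have case2: "closure X = {\<phi>. ev \<phi> 0 = \<alpha>}
      \<and> (\<forall>\<mu>\<in>sum3 U V W. is_max (sharp \<alpha> ?fT (dens \<mu>)) (range (sharp_obj \<alpha> ?fT (dens \<mu>))))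
      \<and> is_max (INF e\<in>F. ereal (f0 e))
        ((\<lambda>\<mu>. ereal (ip (proj1 U V W \<mu>) w) + sharp \<alpha> ?fT (dens \<mu>)) ` sum3 U V W)"
    if N: "\<theta>\<^sub>w + \<theta>\<^sub>p > 1" and \<alpha>: "(w \<longlongrightarrow> \<alpha>) (at_right 0)" for \<alpha>
  proof (intro conjI ballI)
    obtain n where n: "\<theta>\<^sub>p + \<theta>\<^sub>w = Suc n" using N by (cases "\<theta>\<^sub>p + \<theta>\<^sub>w") auto
    have X0: "ev e 0 = \<alpha>" if "e \<in> X" for e
      using X_theta_initial_value[OF ref(1) \<alpha>, of \<theta>\<^sub>p \<theta>\<^sub>w e] that N by (simp add: X)
    have e00: "ev e0 0 = \<alpha>" using X0 e0(1) .
    show "closure X = {\<phi>. ev \<phi> 0 = \<alpha>}"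
    proof
      have "closed {\<phi>. ev \<phi> 0 = \<alpha>}"
        by (intro closed_Collect_eq continuous_on_const linear_continuous_on bounded_linear_ev)
      then show "closure X \<subseteq> {\<phi>. ev \<phi> 0 = \<alpha>}" using X0 by (intro closure_minimal) auto
      show "{\<phi>. ev \<phi> 0 = \<alpha>} \<subseteq> closure X"
        using mem_closure_X_theta[OF e0(1)[unfolded X] n] e00 by (auto simp: X)
    qed
    show "is_max (sharp \<alpha> ?fT (dens g)) (range (sharp_obj \<alpha> ?fT (dens g)))" if "g \<in> sum3 U V W" for g
      using sharp_attained[OF T e0(2) f0, of g] span[OF that] e00 by simp
    show "is_max (INF e\<in>F. ereal (f0 e))
        ((\<lambda>\<mu>. ereal (ip (proj1 U V W \<mu>) w) + sharp \<alpha> ?fT (dens \<mu>)) ` sum3 U V W)"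
    proof (rule is_max_dualI)
      fix g e assume g: "g \<in> sum3 U V W" and e: "e \<in> F"
      have "sharp \<alpha> ?fT (dens g) \<le> ereal (f0 e - ip (proj1 U V W g) w)"
        unfolding sharp_def
      proof (rule SUP_least)
        fix l
        have "ev e 0 = \<alpha>" using X0 e by (simp add: F_iff)
        then have "ereal (ip (proj1 U V W g) w + l * \<alpha> - f0 e) \<le> conjugate ?fT (dens g + l *\<^sub>R delta0)"
          using conjugate_ge[of e T "dens g + l *\<^sub>R delta0" f0] span[OF g] e by (simp add: F_iff pairing_dens_delta0)
        then show "sharp_obj \<alpha> ?fT (dens g) l \<le> ereal (f0 e - ip (proj1 U V W g) w)"
          unfolding sharp_obj_def by (cases "conjugate ?fT (dens g + l *\<^sub>R delta0)") (auto simp: algebra_simps)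
      qed
      then show "ereal (ip (proj1 U V W g) w) + sharp \<alpha> ?fT (dens g) \<le> ereal (f0 e)"
        by (cases "sharp \<alpha> ?fT (dens g)") auto
    next
      fix v assume "\<And>e. e \<in> F \<Longrightarrow> v \<le> f0 e"
      from dual[OF n this] obtain g l where g: "g \<in> sum3 U V W"
          "conjugate ?fT (dens g + l *\<^sub>R delta0) \<le> ereal (ip (proj1 U V W g) w + l * \<alpha> - v)"
        unfolding e00 by blast
      then have "ereal (v - ip (proj1 U V W g) w) \<le> sharp_obj \<alpha> ?fT (dens g) l"
        unfolding sharp_obj_def by (cases "conjugate ?fT (dens g + l *\<^sub>R delta0)") (auto simp: algebra_simps)
      also have "\<dots> \<le> sharp \<alpha> ?fT (dens g)" unfolding sharp_def by (rule SUP_upper) simp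
      finally have "ereal v \<le> ereal (ip (proj1 U V W g) w) + sharp \<alpha> ?fT (dens g)"
        by (cases "sharp \<alpha> ?fT (dens g)") auto
      with g(1) show "\<exists>\<mu>\<in>sum3 U V W. ereal v \<le> ereal (ip (proj1 U V W \<mu>) w) + sharp \<alpha> ?fT (dens \<mu>)" by blast
    qed (use e0F ne in auto)
  qed
  show ?thesis using case1 case2 unfolding F_def by blast
qed

end
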